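(* Let $\alpha,\beta\in\mathcal{M}_{++}(X)$, let $\varepsilon>0$, let $\phi$ be an entropy function and assume that the cost $C$ is $\gamma$-Lipschitz. Assume that the dual program $\sup_{(f,g)\in\mathcal{C}(X)^2}\mathcal{F}(f,g)$ can be restricted to a compact subset of $\mathcal{C}(X)^2$, i.e. there is a compact set $K\subset\mathcal{C}(X)^2$ with $\sup_{K}\mathcal{F}=\sup_{\mathcal{C}(X)^2}\mathcal{F}$. Then there exists an optimal pair of dual potentials (a maximizer of $\mathcal{F}$ in $\mathcal{C}(X)^2$), and for every $g_0\in\mathcal{C}(X)$ the Sinkhorn iterates $(f_t,g_t)$ converge in $\|\cdot\|_\infty$ towards a pair of optimal dual potentials. In particular, the Sinkhorn iterates converge to a pair of optimal dual potentials in each of the following settings: balanced ($\phi=\iota_{\{1\}}$, with $m(\alpha)=m(\beta)$); Kullback-Leibler ($\phi(p)=\rho(p\log p-p+1)$, $\rho>0$); range ($\phi=\iota_{[a,b]}$, $0\le a\le 1\le b$, with $[a\,m(\alpha),b\,m(\alpha)]\cap[a\,m(\beta),b\,m(\beta)]\neq\emptyset$); total variation ($\phi(p)=\rho|p-1|$, $\rho>0$); power entropies ($\phi(p)=\frac{\rho}{s(s-1)}(p^s-s(p-1)-1)$ with $\rho>0$, $s<1$, $s\ne0$, and the limit case $s=0$, the Berg entropy $\phi(p)=\rho(p-1-\log p)$).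
   Context: $(X,d_X)$ is a compact metric space; $\mathcal{C}(X)$ is the space of continuous real functions with the sup norm $\|\cdot\|_\infty$; $\mathcal{M}_+(X)$ is the set of positive (finite) Radon measures, $\mathcal{M}_{++}(X)=\mathcal{M}_+(X)\setminus\{0\}$; $m(\alpha)=\int_X d\alpha$; $\langle\alpha,f\rangle=\int f\,d\alpha$; $(f\oplus g)(x,y)=f(x)+g(y)$. The cost $C:X^2\to\mathbb{R}$ is symmetric and continuous; it is $\gamma$-Lipschitz if $\|C(x,\cdot)-C(y,\cdot)\|_\infty\le\gamma d_X(x,y)$ for all $x,y$. An entropy function is a convex, lower semicontinuous $\phi\ge 0$ on $[0,\infty)$ (values in $[0,+\infty]$; the value at $0$ is the lower semicontinuous extension) with $\phi(1)=0$, extended by $+\infty$ on $(-\infty,0)$. $\iota_A$ is the convex indicator ($0$ on $A$, $+\infty$ outside). Legendre conjugate: $\phi^*(q)=\sup_{p\ge0}pq-\phi(p)$. Dual functional: $\mathcal{F}(f,g)=-\langle\alpha,\phi^*(-f)\rangle-\langle\beta,\phi^*(-g)\rangle-\varepsilon\langle\alpha\otimes\beta,e^{(f\oplus g-C)/\varepsilon}-1\rangle$. Anisotropic proximity operator: $\mathrm{Aprox}^\varepsilon_{\phi^*}(p)=\arg\min_{q\in\mathbb{R}}\ \varepsilon e^{(p-q)/\varepsilon}+\phi^*(q)$. Set $\mathcal{S}_\alpha(f)(y)=-\varepsilon\log\int_X e^{(f(x)-C(x,y))/\varepsilon}d\alpha(x)$, $\mathcal{S}_\beta(g)(x)=-\varepsilon\log\int_X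 e^{(g(y)-C(x,y))/\varepsilon}d\beta(y)$, and $\mathcal{AS}_\alpha(f)=-\mathrm{Aprox}^\varepsilon_{\phi^*}(-\mathcal{S}_\alpha(f))$, $\mathcal{AS}_\beta(g)=-\mathrm{Aprox}^\varepsilon_{\phi^*}(-\mathcal{S}_\beta(g))$ (Aprox applied pointwise). Sinkhorn iterations: from $g_0\in\mathcal{C}(X)$, $f_{t+1}=\mathcal{AS}_\beta(g_t)$, $g_{t+1}=\mathcal{AS}_\alpha(f_{t+1})$. *)

theory Defs
  imports "HOL-Analysis.Analysis"
begin

text \<open>
  The compact metric space is a type of class \<open>metric_space\<close> whose universe is compact; the space of
  continuous real functions with the sup norm is then the library type \<open>'a \<Rightarrow>\<^sub>C real\<close> of bounded
  continuous functions, boundedness being automatic.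
\<close>

definition radon_measures :: "'a::metric_space measure set" where
  "radon_measures = {\<mu>. sets \<mu> = sets borel \<and> finite_measure \<mu> \<and>
     (\<forall>A\<in>sets borel. emeasure \<mu> A = (SUP K\<in>{K. K \<subseteq> A \<and> compact K}. emeasure \<mu> K))}"

definition nonzero_radon_measures :: "'a::metric_space measure set" where
  "nonzero_radon_measures = {\<mu> \<in> radon_measures. emeasure \<mu> UNIV \<noteq> 0}"

definition mass :: "'a measure \<Rightarrow> real" where
  "mass \<mu> = measure \<mu> (space \<mu>)"

text \<open>Integral of an extended-real function, meaningful when the positive or the negative part has
  a finite integral. It is used below for functions that are bounded below.\<close>

definition ereal_integral :: "'a measure \<Rightarrow> ('a \<Rightarrow> ereal) \<Rightarrow> ereal" where
  "ereal_integral \<mu> h =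
     enn2ereal (\<integral>\<^sup>+ x. e2ennreal (h x) \<partial>\<mu>) - enn2ereal (\<integral>\<^sup>+ x. e2ennreal (- h x) \<partial>\<mu>)"

text \<open>Lower semicontinuity and convexity at \<open>0\<close> force \<open>\<phi> 0\<close> to be the limit of \<open>\<phi> p\<close> as
  \<open>p\<close> decreases to \<open>0\<close>.\<close>

definition entropy_function :: "(real \<Rightarrow> ereal) \<Rightarrow> bool" where
  "entropy_function \<phi> \<longleftrightarrow>
     (\<forall>p<0. \<phi> p = \<infinity>) \<and>
     (\<forall>p\<ge>0. 0 \<le> \<phi> p) \<and>
     \<phi> 1 = 0 \<and>
     (\<forall>p\<ge>0. \<forall>q\<ge>0. \<forall>u v. 0 < u \<longrightarrow> 0 < v \<longrightarrow> u + v = 1 \<longrightarrow>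
        \<phi> (u * p + v * q) \<le> ereal u * \<phi> p + ereal v * \<phi> q) \<and>
     (\<forall>p\<ge>0. \<phi> p \<le> Liminf (at p within {0..}) \<phi>)"

definition conj_fun :: "(real \<Rightarrow> ereal) \<Rightarrow> real \<Rightarrow> ereal" where
  "conj_fun \<phi> q = (SUP p\<in>{0..}. ereal (p * q) - \<phi> p)"

definition dual_functional ::
  "real \<Rightarrow> (real \<Rightarrow> ereal) \<Rightarrow> ('a::metric_space \<Rightarrow> 'a \<Rightarrow> real) \<Rightarrow> 'a measure \<Rightarrow> 'a measure
     \<Rightarrow> ('a \<Rightarrow>\<^sub>C real) \<Rightarrow> ('a \<Rightarrow>\<^sub>C real) \<Rightarrow> ereal" where
  "dual_functional \<epsilon> \<phi> C \<alpha> \<beta> f g =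
     - ereal_integral \<alpha> (\<lambda>x. conj_fun \<phi> (- f x))
     - ereal_integral \<beta> (\<lambda>y. conj_fun \<phi> (- g y))
     - ereal (\<epsilon> * (\<integral>(x, y). (exp ((f x + g y - C x y) / \<epsilon>) - 1) \<partial>(\<alpha> \<Otimes>\<^sub>M \<beta>)))"

definition optimal_potentials ::
  "real \<Rightarrow> (real \<Rightarrow> ereal) \<Rightarrow> ('a::metric_space \<Rightarrow> 'a \<Rightarrow> real) \<Rightarrow> 'a measure \<Rightarrow> 'a measure
     \<Rightarrow> ('a \<Rightarrow>\<^sub>C real) \<Rightarrow> ('a \<Rightarrow>\<^sub>C real) \<Rightarrow> bool" where
  "optimal_potentials \<epsilon> \<phi> C \<alpha> \<beta> f g \<longleftrightarrow>
     (\<forall>f' g'. dual_functional \<epsilon> \<phi> C \<alpha> \<beta> f' g' \<le> dual_functional \<epsilon> \<phi> C \<alpha> \<beta> f g)"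

text \<open>For an entropy function the objective is strictly convex where finite, lower semicontinuous
  and coercive (\<open>conj_fun \<phi> q \<ge> q\<close> and \<open>conj_fun \<phi> 0 = 0\<close>), so its minimizer exists and is unique.\<close>

definition aprox :: "real \<Rightarrow> (real \<Rightarrow> ereal) \<Rightarrow> real \<Rightarrow> real" where
  "aprox \<epsilon> \<phi> p = (ARG_MIN (\<lambda>q. ereal (\<epsilon> * exp ((p - q) / \<epsilon>)) + conj_fun \<phi> q) q. True)"

text \<open>In \<open>softmin \<epsilon> c \<mu> h z\<close> the first argument of \<open>c\<close> is integrated out. Hence the operator attached
  to \<open>\<alpha>\<close> uses \<open>C\<close> and the one attached to \<open>\<beta>\<close> uses \<open>\<lambda>y x. C x y\<close>.\<close>

definition softmin ::
  "real \<Rightarrow> ('a \<Rightarrow> 'a \<Rightarrow> real) \<Rightarrow> 'a measure \<Rightarrow> ('a \<Rightarrow> real) \<Rightarrow> 'a \<Rightarrow> real" where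
  "softmin \<epsilon> c \<mu> h z = - \<epsilon> * ln (\<integral>w. exp ((h w - c w z) / \<epsilon>) \<partial>\<mu>)"

definition asoftmin ::
  "real \<Rightarrow> (real \<Rightarrow> ereal) \<Rightarrow> ('a \<Rightarrow> 'a \<Rightarrow> real) \<Rightarrow> 'a measure \<Rightarrow> ('a \<Rightarrow> real) \<Rightarrow> 'a \<Rightarrow> real" where
  "asoftmin \<epsilon> \<phi> c \<mu> h z = - aprox \<epsilon> \<phi> (- softmin \<epsilon> c \<mu> h z)"

text \<open>\<open>sinkhorn_f \<dots> g0 t\<close> is the iterate \<open>f\<close> of index \<open>t + 1\<close>, as there is no \<open>f\<close> of index \<open>0\<close>;
  \<open>sinkhorn_g \<dots> g0 t\<close> is the iterate \<open>g\<close> of index \<open>t\<close>.\<close>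

primrec sinkhorn_g ::
  "real \<Rightarrow> (real \<Rightarrow> ereal) \<Rightarrow> ('a \<Rightarrow> 'a \<Rightarrow> real) \<Rightarrow> 'a measure \<Rightarrow> 'a measure
     \<Rightarrow> ('a \<Rightarrow> real) \<Rightarrow> nat \<Rightarrow> 'a \<Rightarrow> real" where
  "sinkhorn_g \<epsilon> \<phi> C \<alpha> \<beta> g0 0 = g0"
| "sinkhorn_g \<epsilon> \<phi> C \<alpha> \<beta> g0 (Suc t) =
     asoftmin \<epsilon> \<phi> C \<alpha> (asoftmin \<epsilon> \<phi> (\<lambda>y x. C x y) \<beta> (sinkhorn_g \<epsilon> \<phi> C \<alpha> \<beta> g0 t))"

definition sinkhorn_f ::
  "real \<Rightarrow> (real \<Rightarrow> ereal) \<Rightarrow> ('a \<Rightarrow> 'a \<Rightarrow> real) \<Rightarrow> 'a measure \<Rightarrow> 'a measure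
     \<Rightarrow> ('a \<Rightarrow> real) \<Rightarrow> nat \<Rightarrow> 'a \<Rightarrow> real" where
  "sinkhorn_f \<epsilon> \<phi> C \<alpha> \<beta> g0 t =
     asoftmin \<epsilon> \<phi> (\<lambda>y x. C x y) \<beta> (sinkhorn_g \<epsilon> \<phi> C \<alpha> \<beta> g0 t)"

text \<open>The iterates are continuous and converge in sup norm (the topology of \<open>'a \<Rightarrow>\<^sub>C real\<close>).\<close>

definition sinkhorn_converges ::
  "real \<Rightarrow> (real \<Rightarrow> ereal) \<Rightarrow> ('a::metric_space \<Rightarrow> 'a \<Rightarrow> real) \<Rightarrow> 'a measure \<Rightarrow> 'a measure
     \<Rightarrow> ('a \<Rightarrow>\<^sub>C real) \<Rightarrow> bool" where
  "sinkhorn_converges \<epsilon> \<phi> C \<alpha> \<beta> g0 \<longleftrightarrow>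
     (\<exists>(F :: nat \<Rightarrow> 'a \<Rightarrow>\<^sub>C real) (G :: nat \<Rightarrow> 'a \<Rightarrow>\<^sub>C real) f g.
        (\<forall>t. apply_bcontfun (F t) = sinkhorn_f \<epsilon> \<phi> C \<alpha> \<beta> (apply_bcontfun g0) t) \<and>
        (\<forall>t. apply_bcontfun (G t) = sinkhorn_g \<epsilon> \<phi> C \<alpha> \<beta> (apply_bcontfun g0) t) \<and>
        F \<longlonglongrightarrow> f \<and> G \<longlonglongrightarrow> g \<and> optimal_potentials \<epsilon> \<phi> C \<alpha> \<beta> f g)"

definition convex_indicator :: "real set \<Rightarrow> real \<Rightarrow> ereal" where
  "convex_indicator A p = (if p \<in> A then 0 else \<infinity>)"

text \<open>At \<open>p = 0\<close> the convention \<open>ln 0 = 0\<close> gives the limit value \<open>\<rho>\<close>.\<close>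

definition kl_entropy :: "real \<Rightarrow> real \<Rightarrow> ereal" where
  "kl_entropy \<rho> p = (if p < 0 then \<infinity> else ereal (\<rho> * (p * ln p - p + 1)))"

definition tv_entropy :: "real \<Rightarrow> real \<Rightarrow> ereal" where
  "tv_entropy \<rho> p = (if p < 0 then \<infinity> else ereal (\<rho> * \<bar>p - 1\<bar>))"

text \<open>For \<open>s < 0\<close> the limit at \<open>0\<close> is infinite, whereas \<open>0 powr s = 0\<close>; the value is set by hand.
  For \<open>s > 0\<close> the formula is correct at \<open>0\<close>.\<close>

definition power_entropy :: "real \<Rightarrow> real \<Rightarrow> real \<Rightarrow> ereal" where
  "power_entropy \<rho> s p =
     (if p < 0 \<or> (p = 0 \<and> s < 0) then \<infinity>
      else ereal (\<rho> / (s * (s - 1)) * (p powr s - s * (p - 1) - 1)))"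

definition berg_entropy :: "real \<Rightarrow> real \<Rightarrow> ereal" where
  "berg_entropy \<rho> p = (if p \<le> 0 then \<infinity> else ereal (\<rho> * (p - 1 - ln p)))"

end

theory Submission
  imports Defs
begin

text \<open>
  Write \<open>T\<close> for one sweep \<open>g\<^sub>t \<mapsto> g\<^sub>t\<^sub>+\<^sub>1\<close>. The softmin and the proximity operator are monotone and
  nonexpansive for the sup norm, hence so is \<open>T\<close>, and its values are \<open>\<gamma>\<close>-Lipschitz, so bounded orbits are
  relatively compact. The softmin is strictly contracting except along constants. Hence, as soon as
  \<open>T\<close> has a fixed point, every cluster point of an orbit is mapped to a fixed point, and
  nonexpansiveness makes the orbit converge to it. Integrating the first-order condition of the
  proximity operator shows that a fixed point gives optimal potentials; conversely, optimal potentials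
  agree almost everywhere with a fixed point.

  For the concrete entropies a fixed point of \<open>T\<close> is a limit of fixed points of the contractions
  \<open>g \<mapsto> T (r g)\<close> as \<open>r\<close> tends to \<open>1\<close>. These stay bounded because the subgradients of \<open>\<phi>\<^sup>*\<close> far from \<open>0\<close>
  would otherwise force incompatible masses on the two marginals of the coupling.
\<close>

subsection \<open>The conjugate and its proximity operator\<close>

text \<open>In the balanced case the conjugate is the identity and the sweep commutes with adding
  constants, so it is no contraction and its fixed points are not unique; this is why convergence
  rests on rigidity and existence on discounting. In general the conjugate may take the value
  \<infinity> and need not be differentiable. Optimality is therefore tested only at pairs
  \<open>(AS \<beta> k, AS \<alpha> l)\<close>: there the proximity operator itself supplies a
  finite value and a subgradient, which is an exponential of potential minus softmin. The measures
  may charge only a part of the space, so rigidity and uniqueness hold almost everywhere. But a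
  half-step sees its argument only up to null sets and returns a function determined at every point;
  one further half-step gives exact identities. At a discounted fixed point the two first-order
  conditions refer to different couplings, those of \<open>(f, r g)\<close> and
  \<open>(f, g)\<close>. The sign of \<open>g\<close> orders their masses strictly, whereas the
  conditions order them the other way once \<open>g\<close> is far from 0; hence a bound uniform in
  \<open>r\<close>.\<close>

definition conj_subgradient :: "(real \<Rightarrow> ereal) \<Rightarrow> real \<Rightarrow> real \<Rightarrow> bool" where
  "conj_subgradient \<phi> q s \<longleftrightarrow>
     (\<exists>u. conj_fun \<phi> q = ereal u \<and> (\<forall>r. ereal (u + s * (r - q)) \<le> conj_fun \<phi> r))"

lemma conj_fun_ge: "0 \<le> p \<Longrightarrow> ereal (p * q) - \<phi> p \<le> conj_fun \<phi> q"
  unfolding conj_fun_def by (intro SUP_upper) auto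

lemma conj_fun_convex:
  assumes "conj_fun \<phi> q = ereal u" "conj_fun \<phi> r = ereal v" "0 \<le> t" "t \<le> 1"
  shows "conj_fun \<phi> (q + t * (r - q)) \<le> ereal ((1 - t) * u + t * v)"
  unfolding conj_fun_def
proof (rule SUP_least)
  fix p :: real assume "p \<in> {0..}"
  then have p: "ereal (p * q) - \<phi> p \<le> ereal u" "ereal (p * r) - \<phi> p \<le> ereal v"
    using conj_fun_ge[of p q \<phi>] conj_fun_ge[of p r \<phi>] assms by auto
  show "ereal (p * (q + t * (r - q))) - \<phi> p \<le> ereal ((1 - t) * u + t * v)"
  proof (cases "\<phi> p")
    case (real w)
    then have "p * q - w \<le> u" "p * r - w \<le> v" using p by auto
    then have "(1 - t) * (p * q - w) \<le> (1 - t) * u" "t * (p * r - w) \<le> t * v"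
      using assms by (auto intro: mult_left_mono)
    then have "(1 - t) * (p * q - w) + t * (p * r - w) \<le> (1 - t) * u + t * v" by linarith
    then show ?thesis using real by (simp add: algebra_simps)
  qed (use p in auto)
qed

text \<open>The slope 2 beats the slope 1 of the minorant \<open>conj_ge_id\<close>, which makes the
  proximity objective coercive at minus infinity. For \<open>x \<ge> 0\<close> the quadratic Taylor
  bound exceeds \<open>2 * x\<close> by \<open>((x - 1)\<^sup>2 + 1) / 2\<close>.\<close>

lemma two_mult_le_exp: "2 * x \<le> exp x" for x :: real
proof (cases "0 \<le> x")
  case True
  have "0 \<le> (x - 1)\<^sup>2" by simp
  then show ?thesis
    using exp_lower_Taylor_quadratic[OF True] by (simp add: power2_eq_square algebra_simps)
next
  case False
  then show ?thesis using exp_gt_zero[of x] by linarith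
qed

locale entropic =
  fixes \<phi> :: "real \<Rightarrow> ereal" and \<epsilon> :: real
  assumes eps_pos: "0 < \<epsilon>"
    and phi_nonneg: "0 \<le> p \<Longrightarrow> 0 \<le> \<phi> p"
    and phi_one: "\<phi> 1 = 0"
begin

lemma conj_ge_id: "ereal q \<le> conj_fun \<phi> q"
  using conj_fun_ge[of 1 q \<phi>] phi_one by simp

lemma conj_zero: "conj_fun \<phi> 0 = 0"
proof (rule antisym)
  show "conj_fun \<phi> 0 \<le> 0"
    unfolding conj_fun_def using phi_nonneg
    by (intro SUP_least) (auto simp: ereal_minus_le_iff zero_ereal_def[symmetric])
  show "0 \<le> conj_fun \<phi> 0" using conj_ge_id[of 0] by (simp add: zero_ereal_def)
qed

abbreviation aprox_objective :: "real \<Rightarrow> real \<Rightarrow> ereal" where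
  "aprox_objective p q \<equiv> ereal (\<epsilon> * exp ((p - q) / \<epsilon>)) + conj_fun \<phi> q"

lemma aprox_objective_sublevel:
  assumes "aprox_objective p q \<le> ereal c"
  shows "q \<in> {2 * p - c..c}"
proof -
  have "ereal (\<epsilon> * exp ((p - q) / \<epsilon>)) + ereal q \<le> ereal c"
    using assms conj_ge_id[of q] by (meson add_left_mono order_trans)
  then have *: "\<epsilon> * exp ((p - q) / \<epsilon>) + q \<le> c" by simp
  have "\<epsilon> * (2 * ((p - q) / \<epsilon>)) \<le> \<epsilon> * exp ((p - q) / \<epsilon>)"
    by (intro mult_left_mono[OF two_mult_le_exp]) (use eps_pos in simp)
  then have "2 * (p - q) \<le> \<epsilon> * exp ((p - q) / \<epsilon>)" using eps_pos by simp
  moreover have "0 \<le> \<epsilon> * exp ((p - q) / \<epsilon>)" using eps_pos by simp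
  ultimately show ?thesis using * by auto
qed

text \<open>Direct method: the value at 0 is finite by \<open>conj_zero\<close>, so a minimizing
  sequence can be kept in the compact interval of \<open>aprox_objective_sublevel\<close>.\<close>

lemma aprox_objective_has_min: "\<exists>l. \<forall>q. aprox_objective p l \<le> aprox_objective p q"
proof -
  define J where "J = aprox_objective p"
  define c where "c = \<epsilon> * exp (p / \<epsilon>)"
  define S where "S = {q. J q \<le> ereal c}"
  have J0: "J 0 = ereal c" by (simp add: J_def c_def conj_zero)
  then have "0 \<in> S" by (simp add: S_def)
  then have "J ` S \<noteq> {}" by blast
  from Inf_countable_INF[OF this] obtain y where y: "decseq y" "range y \<subseteq> J ` S"
    "Inf (J ` S) = (INF n::nat. y n)" by blast
  have "\<forall>n. \<exists>x. x \<in> S \<and> y n = J x" using y(2) by auto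
  then obtain x where x: "\<And>n. x n \<in> S" "\<And>n. y n = J (x n)" by metis
  have "\<forall>n. x n \<in> {2 * p - c..c}"
    using x(1) aprox_objective_sublevel[of p] by (auto simp: S_def J_def simp del: atLeastAtMost_iff)
  then obtain l r where l: "strict_mono r" "(x \<circ> r) \<longlonglongrightarrow> l"
    using compact_Icc[of "2 * p - c" c] unfolding compact_def by meson
  define I where "I = Inf (J ` S)"
  have "y \<longlonglongrightarrow> I" using LIMSEQ_INF[OF y(1)] y(3) by (simp add: I_def)
  then have yI: "(y \<circ> r) \<longlonglongrightarrow> I" using l(1) LIMSEQ_subseq_LIMSEQ by blast
  \<comment> \<open>Lower semicontinuity, one affine minorant of the conjugate at a time: each is
    continuous and passes to the limit, and the supremum is taken last.\<close>
  have "conj_fun \<phi> l \<le> I - ereal (\<epsilon> * exp ((p - l) / \<epsilon>))"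
    unfolding conj_fun_def
  proof (rule SUP_least)
    fix p' :: real assume p': "p' \<in> {0..}"
    show "ereal (p' * l) - \<phi> p' \<le> I - ereal (\<epsilon> * exp ((p - l) / \<epsilon>))"
    proof (cases "\<phi> p'")
      case (real w)
      have "(\<lambda>n. \<epsilon> * exp ((p - (x \<circ> r) n) / \<epsilon>) + (p' * (x \<circ> r) n - w))
          \<longlonglongrightarrow> \<epsilon> * exp ((p - l) / \<epsilon>) + (p' * l - w)"
        by (intro tendsto_intros l) (use eps_pos in auto)
      moreover have "ereal (\<epsilon> * exp ((p - (x \<circ> r) n) / \<epsilon>) + (p' * (x \<circ> r) n - w)) \<le> (y \<circ> r) n" for n
        using conj_fun_ge[of p' "x (r n)" \<phi>] p' real
        by (simp add: x J_def plus_ereal.simps(1)[symmetric] add_left_mono del: plus_ereal.simps(1))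
      ultimately have "ereal (\<epsilon> * exp ((p - l) / \<epsilon>) + (p' * l - w)) \<le> I"
        by (intro LIMSEQ_le[OF tendsto_ereal yI]) auto
      then show ?thesis using real by (cases I) (auto simp: algebra_simps)
    qed (use phi_nonneg[of p'] p' in auto)
  qed
  then have JI: "J l \<le> I" unfolding J_def by (simp add: ereal_le_minus add.commute)
  have Iq: "I \<le> J q" if "J q \<le> ereal c" for q
    unfolding I_def using that by (intro Inf_lower) (auto simp: S_def)
  have "J l \<le> J q" for q
    using JI Iq[of q] Iq[of 0] J0 by (cases "J q \<le> ereal c") auto
  then show ?thesis unfolding J_def by blast
qed

text \<open>The first-order condition is obtained by comparing the objective at \<open>l\<close> with its value at
  \<open>l + t (r - l)\<close> and letting \<open>t\<close> tend to \<open>0\<close>.\<close>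

lemma min_imp_subgradient:
  assumes min: "\<And>q. aprox_objective p l \<le> aprox_objective p q"
  shows "conj_subgradient \<phi> l (exp ((p - l) / \<epsilon>))"
proof -
  have "aprox_objective p l \<le> ereal (\<epsilon> * exp (p / \<epsilon>))" using min[of 0] by (simp add: conj_zero)
  then obtain u where u: "conj_fun \<phi> l = ereal u"
    using conj_ge_id[of l] by (cases "conj_fun \<phi> l") auto
  have "ereal (u + exp ((p - l) / \<epsilon>) * (r - l)) \<le> conj_fun \<phi> r" for r
  proof (cases "conj_fun \<phi> r")
    case (real v)
    define h where "h t = exp ((p - (l + t * (r - l))) / \<epsilon>) * (r - l)" for t
    have "h t \<le> v - u" if t: "0 < t" "t \<le> 1" for t
    proof -
      define m where "m = l + t * (r - l)"
      have "ereal (\<epsilon> * exp ((p - l) / \<epsilon>)) + ereal u \<le> aprox_objective p m"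
        using min[of m] u by simp
      also have "\<dots> \<le> ereal (\<epsilon> * exp ((p - m) / \<epsilon>)) + ereal ((1 - t) * u + t * v)"
        unfolding m_def using conj_fun_convex[OF u real] t by (intro add_left_mono) auto
      finally have 1: "\<epsilon> * exp ((p - l) / \<epsilon>) + u \<le> \<epsilon> * exp ((p - m) / \<epsilon>) + ((1 - t) * u + t * v)"
        by simp
      \<comment> \<open>The exponential is linearised at \<open>m\<close>, not at \<open>l\<close>;
        the factor \<open>t\<close> then cancels exactly and only the limit of \<open>h\<close> at 0
        remains.\<close>
      have "exp ((p - m) / \<epsilon>) * (1 + (m - l) / \<epsilon>) \<le> exp ((p - m) / \<epsilon>) * exp ((m - l) / \<epsilon>)"
        by (intro mult_left_mono exp_ge_add_one_self) auto
      also have "\<dots> = exp ((p - l) / \<epsilon>)"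
        by (simp add: exp_add[symmetric] add_divide_distrib[symmetric])
      finally have "\<epsilon> * (exp ((p - m) / \<epsilon>) * (1 + (m - l) / \<epsilon>)) \<le> \<epsilon> * exp ((p - l) / \<epsilon>)"
        using eps_pos by simp
      moreover have "\<epsilon> * (exp ((p - m) / \<epsilon>) * (1 + (m - l) / \<epsilon>))
          = \<epsilon> * exp ((p - m) / \<epsilon>) + exp ((p - m) / \<epsilon>) * (m - l)"
        using eps_pos by (simp add: distrib_left)
      ultimately have "exp ((p - m) / \<epsilon>) * (m - l) \<le> t * (v - u)"
        using 1 by (simp add: algebra_simps)
      then have "t * h t \<le> t * (v - u)" by (simp add: h_def m_def mult.left_commute)
      then show ?thesis using t by simp
    qed
    then have "\<forall>\<^sub>F t in at_right 0. h t \<le> v - u"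
      unfolding eventually_at_right_field by (intro exI[of _ 1]) auto
    moreover have "(h \<longlongrightarrow> h 0) (at_right 0)"
      unfolding h_def by (intro tendsto_intros) (use eps_pos in auto)
    ultimately have "h 0 \<le> v - u"
      by (intro tendsto_upperbound[of h "h 0" "at_right 0"]) auto
    then show ?thesis using real by (simp add: h_def)
  qed (use conj_ge_id[of r] in auto)
  then show ?thesis using u unfolding conj_subgradient_def by blast
qed

lemma subgradient_mono:
  assumes "conj_subgradient \<phi> q s" "conj_subgradient \<phi> q' s'" "q < q'"
  shows "s \<le> s'"
proof -
  obtain u u' where u: "conj_fun \<phi> q = ereal u" "conj_fun \<phi> q' = ereal u'"
    using assms unfolding conj_subgradient_def by auto
  have "u + s * (q' - q) \<le> u'" "u' + s' * (q - q') \<le> u"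
    using assms(1,2) u by (auto simp: conj_subgradient_def dest: spec[of _ q] spec[of _ q'])
  then have "(s - s') * (q' - q) \<le> 0" by (simp add: algebra_simps)
  then show ?thesis using assms(3) by (simp add: mult_le_0_iff)
qed

text \<open>By monotonicity of subgradients, \<open>p - q\<close> cannot decrease when
  \<open>q\<close> increases. So neither \<open>q\<close> nor \<open>p - q\<close> can decrease when
  \<open>p\<close> grows: the proximity operator is monotone and 1-Lipschitz. The case
  \<open>p = p'\<close> gives uniqueness.\<close>

lemma subgradient_exp_shift:
  assumes "conj_subgradient \<phi> q (exp ((p - q) / \<epsilon>))"
    and "conj_subgradient \<phi> q' (exp ((p' - q') / \<epsilon>))" and "p \<le> p'"
  shows "q \<le> q' \<and> q' - q \<le> p' - p"
proof
  have mono: "p - q \<le> p' - q'" if "q < q'"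
    using subgradient_mono[OF assms(1,2) that] eps_pos by (simp add: divide_le_cancel)
  show "q' - q \<le> p' - p" using mono assms(3) by (cases "q < q'") auto
  have "p' - q' \<le> p - q" if "q' < q"
    using subgradient_mono[OF assms(2,1) that] eps_pos by (simp add: divide_le_cancel)
  then show "q \<le> q'" using assms(3) by force
qed

lemma aprox_subgradient: "conj_subgradient \<phi> (aprox \<epsilon> \<phi> p) (exp ((p - aprox \<epsilon> \<phi> p) / \<epsilon>))"
proof -
  obtain l where "\<forall>q. aprox_objective p l \<le> aprox_objective p q"
    using aprox_objective_has_min by blast
  then have "is_arg_min (aprox_objective p) (\<lambda>_. True) l"
    unfolding is_arg_min_def by (auto simp: not_less)
  then have "is_arg_min (aprox_objective p) (\<lambda>_. True) (aprox \<epsilon> \<phi> p)"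
    unfolding aprox_def arg_min_def by (rule someI)
  then show ?thesis
    unfolding is_arg_min_def by (intro min_imp_subgradient) (auto simp: not_less)
qed

lemma aprox_mono: "p \<le> p' \<Longrightarrow> aprox \<epsilon> \<phi> p \<le> aprox \<epsilon> \<phi> p'"
  and aprox_diff_le: "p \<le> p' \<Longrightarrow> aprox \<epsilon> \<phi> p' - aprox \<epsilon> \<phi> p \<le> p' - p"
  using subgradient_exp_shift[OF aprox_subgradient aprox_subgradient] by auto

lemma aprox_nonexpansive: "\<bar>aprox \<epsilon> \<phi> p - aprox \<epsilon> \<phi> p'\<bar> \<le> \<bar>p - p'\<bar>"
  using aprox_mono[of p p'] aprox_diff_le[of p p'] aprox_mono[of p' p] aprox_diff_le[of p' p]
  by linarith

text \<open>The conjugate lies above the identity and touches it at 0, so 1 is a subgradient there.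
  Testing the subgradient at \<open>q\<close> against the point 0 gives
  \<open>q \<le> s * q\<close>.\<close>

lemma subgradient_le_one: "conj_subgradient \<phi> q s \<Longrightarrow> q < 0 \<Longrightarrow> s \<le> 1"
  and subgradient_ge_one: "conj_subgradient \<phi> q s \<Longrightarrow> 0 < q \<Longrightarrow> 1 \<le> s"
proof -
  have *: "q \<le> s * q" if sub: "conj_subgradient \<phi> q s"
  proof -
    obtain u where u: "conj_fun \<phi> q = ereal u" "ereal (u + s * (0 - q)) \<le> conj_fun \<phi> 0"
      using sub unfolding conj_subgradient_def by blast
    then show ?thesis using conj_ge_id[of q] by (simp add: conj_zero)
  qed
  show "conj_subgradient \<phi> q s \<Longrightarrow> q < 0 \<Longrightarrow> s \<le> 1"
    "conj_subgradient \<phi> q s \<Longrightarrow> 0 < q \<Longrightarrow> 1 \<le> s"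
    using * mult_less_cancel_right[of 1 q s] mult_less_cancel_right[of s q 1] by fastforce+
qed

end

subsection \<open>The softmin operator\<close>

definition nonzero_finite_borel :: "'a::topological_space measure \<Rightarrow> bool" where
  "nonzero_finite_borel \<mu> \<longleftrightarrow>
     sets \<mu> = sets borel \<and> finite_measure \<mu> \<and> emeasure \<mu> UNIV \<noteq> 0"

lemma nonzero_finite_borelD:
  assumes "nonzero_finite_borel \<mu>"
  shows "sets \<mu> = sets borel" "finite_measure \<mu>" "space \<mu> = UNIV" "\<not> (AE x in \<mu>. False)"
proof -
  show *: "sets \<mu> = sets borel" "finite_measure \<mu>" using assms by (auto simp: nonzero_finite_borel_def)
  then show sp: "space \<mu> = UNIV" using sets_eq_imp_space_eq by fastforce
  show "\<not> (AE x in \<mu>. False)"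
    using assms sp by (simp add: AE_iff_measurable[of UNIV \<mu>] * nonzero_finite_borel_def)
qed

locale compact_metric =
  fixes X :: "'a::metric_space itself"
  assumes compact_UNIV: "compact (UNIV :: 'a set)"
begin

lemma bounded_continuous:
  fixes h :: "'a \<Rightarrow> real"
  assumes "continuous_on UNIV h"
  obtains B where "\<And>x. \<bar>h x\<bar> \<le> B"
proof -
  have "bounded (range h)"
    using compact_continuous_image[OF assms compact_UNIV] by (rule compact_imp_bounded)
  then show ?thesis using that by (auto simp: bounded_iff)
qed

lemma Bcontfun_apply:
  fixes h :: "'a \<Rightarrow> real"
  assumes "continuous_on UNIV h"
  shows "apply_bcontfun (Bcontfun h) = h"
proof -
  obtain B where "\<And>x. \<bar>h x\<bar> \<le> B" using bounded_continuous[OF assms] by blast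
  then show ?thesis using assms by (intro Bcontfun_inverse bcontfun_normI) auto
qed

lemma integrable_continuous:
  fixes h :: "'a \<Rightarrow> real"
  assumes "nonzero_finite_borel \<mu>" "continuous_on UNIV h"
  shows "integrable \<mu> h"
proof -
  note \<mu> = nonzero_finite_borelD[OF assms(1)]
  interpret finite_measure \<mu> by fact
  obtain B where "\<And>x. \<bar>h x\<bar> \<le> B" using bounded_continuous[OF assms(2)] by blast
  moreover have "h \<in> borel_measurable \<mu>"
    using borel_measurable_continuous_onI[OF assms(2)] \<mu>(1) by (simp cong: measurable_cong_sets)
  ultimately show ?thesis by (intro integrable_const_bound[of _ B]) auto
qed

lemma integral_pos:
  assumes "nonzero_finite_borel \<mu>" "continuous_on UNIV h" "\<And>x. 0 < (h x :: real)"
  shows "0 < integral\<^sup>L \<mu> (h :: 'a \<Rightarrow> real)"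
proof -
  have "AE x in \<mu>. 0 \<le> h x" using assms(3) by (auto intro: less_imp_le)
  moreover have "\<not> (AE x in \<mu>. h x = 0)"
    using assms(3) nonzero_finite_borelD(4)[OF assms(1)] by (simp add: less_imp_neq[symmetric])
  ultimately have "integral\<^sup>L \<mu> h \<noteq> 0"
    using integral_nonneg_eq_0_iff_AE[OF integrable_continuous[OF assms(1,2)]] by simp
  moreover have "0 \<le> integral\<^sup>L \<mu> h" using assms(3) by (intro Bochner_Integration.integral_nonneg) (auto intro: less_imp_le)
  ultimately show ?thesis by simp
qed

end

text \<open>Log-sum-exp. With the cost absorbed into the argument it is monotone and commutes with
  adding constants, so all estimates reduce to comparisons of the form
  \<open>u \<le> v + d\<close>.\<close>

definition lse :: "real \<Rightarrow> 'a measure \<Rightarrow> ('a \<Rightarrow> real) \<Rightarrow> real" where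
  "lse \<epsilon> \<mu> u = \<epsilon> * ln (\<integral>w. exp (u w / \<epsilon>) \<partial>\<mu>)"

lemma softmin_eq_lse: "softmin \<epsilon> c \<mu> h z = - lse \<epsilon> \<mu> (\<lambda>w. h w - c w z)"
  by (simp add: softmin_def lse_def)

context compact_metric
begin

context
  fixes \<epsilon> :: real and \<mu> :: "'a measure"
  assumes \<epsilon>: "0 < \<epsilon>" and \<mu>: "nonzero_finite_borel \<mu>"
begin

lemma cont_exp_div:
  fixes u :: "'a \<Rightarrow> real"
  shows "continuous_on UNIV u \<Longrightarrow> continuous_on UNIV (\<lambda>x. exp (u x / \<epsilon>))"
  by (intro continuous_intros) (use \<epsilon> in auto)

text \<open>The free constant \<open>a\<close> serves as the shift in comparisons and later, in
  \<open>exp_smin\<close>, as the value of the potential in the variable that is not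
  integrated.\<close>

lemma exp_lse:
  fixes u :: "'a \<Rightarrow> real"
  assumes "continuous_on UNIV u"
  shows "exp ((a + lse \<epsilon> \<mu> u) / \<epsilon>) = (\<integral>w. exp ((a + u w) / \<epsilon>) \<partial>\<mu>)"
proof -
  have "0 < (\<integral>w. exp (u w / \<epsilon>) \<partial>\<mu>)" by (intro integral_pos \<mu> cont_exp_div assms) simp
  then show ?thesis using \<epsilon> by (simp add: lse_def add_divide_distrib exp_add)
qed

lemma lse_le_iff:
  fixes u v :: "'a \<Rightarrow> real"
  assumes "continuous_on UNIV u" "continuous_on UNIV v"
  shows "lse \<epsilon> \<mu> u \<le> lse \<epsilon> \<mu> v + d \<longleftrightarrow>
    (\<integral>w. exp (u w / \<epsilon>) \<partial>\<mu>) \<le> (\<integral>w. exp ((d + v w) / \<epsilon>) \<partial>\<mu>)"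
proof -
  have "lse \<epsilon> \<mu> u \<le> lse \<epsilon> \<mu> v + d \<longleftrightarrow> exp ((0 + lse \<epsilon> \<mu> u) / \<epsilon>) \<le> exp ((d + lse \<epsilon> \<mu> v) / \<epsilon>)"
    using \<epsilon> by (simp add: divide_le_cancel add.commute)
  then show ?thesis unfolding exp_lse[OF assms(1)] exp_lse[OF assms(2)] by simp
qed

lemma lse_mono:
  fixes u v :: "'a \<Rightarrow> real"
  assumes "continuous_on UNIV u" "continuous_on UNIV v" "AE w in \<mu>. u w \<le> v w + d"
  shows "lse \<epsilon> \<mu> u \<le> lse \<epsilon> \<mu> v + d"
  unfolding lse_le_iff[OF assms(1,2)]
proof (intro integral_mono_AE integrable_continuous \<mu> cont_exp_div)
  show "AE w in \<mu>. exp (u w / \<epsilon>) \<le> exp ((d + v w) / \<epsilon>)"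
    using assms(3) by eventually_elim (use \<epsilon> in \<open>simp add: divide_le_cancel add.commute\<close>)
qed (intro continuous_intros assms)+

text \<open>The equality case of \<open>lse_mono\<close>: the nonnegative difference of the two
  exponentials has zero integral.\<close>

lemma lse_rigid:
  fixes u v :: "'a \<Rightarrow> real"
  assumes "continuous_on UNIV u" "continuous_on UNIV v" "\<And>w. u w \<le> v w + d"
    and "lse \<epsilon> \<mu> v + d \<le> lse \<epsilon> \<mu> u"
  shows "AE w in \<mu>. u w = v w + d"
proof -
  define h where "h w = exp ((d + v w) / \<epsilon>) - exp (u w / \<epsilon>)" for w
  have h_cont: "continuous_on UNIV h"
    unfolding h_def by (intro continuous_intros assms) (use \<epsilon> in auto)
  have h_nonneg: "0 \<le> h w" for w
    using assms(3)[of w] \<epsilon> by (simp add: h_def divide_le_cancel add.commute)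
  have "lse \<epsilon> \<mu> v \<le> lse \<epsilon> \<mu> u + (- d)" using assms(4) by simp
  then have "exp ((d + lse \<epsilon> \<mu> v) / \<epsilon>) \<le> exp ((0 + lse \<epsilon> \<mu> u) / \<epsilon>)"
    using \<epsilon> by (simp add: divide_le_cancel add.commute)
  then have "(\<integral>w. exp ((d + v w) / \<epsilon>) \<partial>\<mu>) \<le> (\<integral>w. exp (u w / \<epsilon>) \<partial>\<mu>)"
    unfolding exp_lse[OF assms(1)] exp_lse[OF assms(2)] by simp
  moreover have "integral\<^sup>L \<mu> h = (\<integral>w. exp ((d + v w) / \<epsilon>) \<partial>\<mu>) - (\<integral>w. exp (u w / \<epsilon>) \<partial>\<mu>)"
    unfolding h_def
    by (intro Bochner_Integration.integral_diff integrable_continuous \<mu> cont_exp_div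
        continuous_intros assms)
  moreover have "0 \<le> integral\<^sup>L \<mu> h" using h_nonneg by (intro Bochner_Integration.integral_nonneg) auto
  ultimately have "integral\<^sup>L \<mu> h = 0" by simp
  then have "AE w in \<mu>. h w = 0"
    using integral_nonneg_eq_0_iff_AE[OF integrable_continuous[OF \<mu> h_cont]] h_nonneg by simp
  then show ?thesis by eventually_elim (use \<epsilon> in \<open>simp add: h_def\<close>)
qed

end

end

section \<open>Half-steps: softmin followed by the proximity operator\<close>

locale sinkhorn = entropic \<phi> \<epsilon> + compact_metric "TYPE('a::metric_space)"
  for \<phi> :: "real \<Rightarrow> ereal" and \<epsilon> :: real +
  fixes C :: "'a::metric_space \<Rightarrow> 'a \<Rightarrow> real" and \<gamma> :: real
  assumes C_sym: "C x y = C y x"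
    and C_lipschitz: "\<bar>C x z - C y z\<bar> \<le> \<gamma> * dist x y"
    and \<gamma>_nonneg: "0 \<le> \<gamma>"
begin

lemma C_lipschitz2: "\<bar>C z x - C z y\<bar> \<le> \<gamma> * dist x y"
  using C_lipschitz[of x z y] by (simp add: C_sym)

lemma lipschitz_continuous:
  fixes h :: "'a \<Rightarrow> real"
  assumes "\<And>x y. \<bar>h x - h y\<bar> \<le> \<gamma> * dist x y"
  shows "continuous_on UNIV h"
proof -
  have "\<gamma>-lipschitz_on UNIV h"
    using assms \<gamma>_nonneg by (intro lipschitz_onI) (auto simp: dist_real_def)
  then show ?thesis by (rule lipschitz_on_continuous_on)
qed

lemma C_cont [continuous_intros]: "continuous_on UNIV (\<lambda>w. C w z)"
  by (rule lipschitz_continuous) (rule C_lipschitz)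

lemma bcontfun_minus_C_cont:
  "continuous_on UNIV (\<lambda>w. apply_bcontfun h w - C w z)"
  by (intro continuous_intros) auto

definition AS :: "'a measure \<Rightarrow> ('a \<Rightarrow>\<^sub>C real) \<Rightarrow> 'a \<Rightarrow>\<^sub>C real" where
  "AS \<mu> h = Bcontfun (asoftmin \<epsilon> \<phi> C \<mu> (apply_bcontfun h))"

abbreviation smin :: "'a measure \<Rightarrow> ('a \<Rightarrow>\<^sub>C real) \<Rightarrow> 'a \<Rightarrow> real" where
  "smin \<mu> h \<equiv> softmin \<epsilon> C \<mu> (apply_bcontfun h)"

text \<open>\<open>D\<close> bounds the oscillation of every output of a half-step.\<close>

lemma diameter_bound:
  obtains D where "0 \<le> D" "\<And>x y :: 'a. \<gamma> * dist x y \<le> D"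
proof -
  obtain e where "\<And>x y :: 'a. dist x y \<le> e"
    using compact_imp_bounded[OF compact_UNIV] by (auto simp: bounded_two_points)
  then have "\<gamma> * dist x y \<le> \<gamma> * e" for x y :: 'a using \<gamma>_nonneg by (intro mult_left_mono)
  then show ?thesis using that[of "\<bar>\<gamma> * e\<bar>"] by (meson abs_ge_self abs_ge_zero order_trans)
qed

context
  fixes \<mu> :: "'a measure"
  assumes \<mu>: "nonzero_finite_borel \<mu>"
begin

lemma smin_le:
  assumes "AE w in \<mu>. apply_bcontfun h w \<le> apply_bcontfun k w + d"
  shows "smin \<mu> k z \<le> smin \<mu> h z + d"
  using lse_mono[OF eps_pos \<mu> bcontfun_minus_C_cont[of h z] bcontfun_minus_C_cont[of k z], of d] assms
  by (simp add: softmin_eq_lse)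

lemma smin_rigid:
  assumes "\<And>w. apply_bcontfun h w \<le> apply_bcontfun k w + d" "smin \<mu> h z + d \<le> smin \<mu> k z"
  shows "AE w in \<mu>. apply_bcontfun h w = apply_bcontfun k w + d"
  using lse_rigid[OF eps_pos \<mu> bcontfun_minus_C_cont[of h z] bcontfun_minus_C_cont[of k z], of d] assms
  by (simp add: softmin_eq_lse)

text \<open>Moving \<open>z\<close> changes the cost by at most \<open>\<gamma> * dist z z'\<close>
  uniformly in the integration variable, and \<open>lse\<close> transmits a uniform change without
  enlarging it.\<close>

lemma smin_lipschitz: "\<bar>smin \<mu> h z - smin \<mu> h z'\<bar> \<le> \<gamma> * dist z z'"
proof -
  have "smin \<mu> h z' \<le> smin \<mu> h z + \<gamma> * dist z z'" for z z'
  proof -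
    have "apply_bcontfun h w - C w z \<le> apply_bcontfun h w - C w z' + \<gamma> * dist z z'" for w
      using C_lipschitz2[of w z z'] by linarith
    then show ?thesis
      using lse_mono[OF eps_pos \<mu> bcontfun_minus_C_cont[of h z] bcontfun_minus_C_cont[of h z'],
          of "\<gamma> * dist z z'"]
      by (simp add: softmin_eq_lse)
  qed
  from this[of z z'] this[of z' z] show ?thesis by (simp add: dist_commute abs_le_iff)
qed

lemma exp_smin:
  "exp ((a - smin \<mu> h z) / \<epsilon>) = (\<integral>w. exp ((a + apply_bcontfun h w - C w z) / \<epsilon>) \<partial>\<mu>)"
  using exp_lse[OF eps_pos \<mu> bcontfun_minus_C_cont[of h z], of a]
  by (simp add: softmin_eq_lse algebra_simps)

lemma smin_cont: "continuous_on UNIV (smin \<mu> h)"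
  by (rule lipschitz_continuous) (rule smin_lipschitz)

lemma smin_zero_bounded: obtains K where "0 \<le> K" "\<And>z. \<bar>smin \<mu> 0 z\<bar> \<le> K"
proof -
  obtain K where "\<And>z. \<bar>smin \<mu> 0 z\<bar> \<le> K"
    using bounded_continuous[OF smin_cont[of 0]] by blast
  moreover from this have "0 \<le> K" using abs_ge_zero order_trans by blast
  ultimately show ?thesis using that by blast
qed

lemma AS_apply_smin_lipschitz:
  "\<bar>asoftmin \<epsilon> \<phi> C \<mu> (apply_bcontfun h) z - asoftmin \<epsilon> \<phi> C \<mu> (apply_bcontfun h) z'\<bar> \<le> \<gamma> * dist z z'"
  using aprox_nonexpansive[of "- smin \<mu> h z" "- smin \<mu> h z'"] smin_lipschitz[of h z z']
  unfolding asoftmin_def by linarith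

lemma AS_apply: "apply_bcontfun (AS \<mu> h) = asoftmin \<epsilon> \<phi> C \<mu> (apply_bcontfun h)"
  unfolding AS_def by (intro Bcontfun_apply lipschitz_continuous AS_apply_smin_lipschitz)

lemma AS_eq: "apply_bcontfun (AS \<mu> h) z = - aprox \<epsilon> \<phi> (- smin \<mu> h z)"
  by (simp add: AS_apply asoftmin_def)

lemma AS_lipschitz: "\<bar>apply_bcontfun (AS \<mu> h) z - apply_bcontfun (AS \<mu> h) z'\<bar> \<le> \<gamma> * dist z z'"
  unfolding AS_apply by (rule AS_apply_smin_lipschitz)

lemma AS_diff_le: "\<bar>apply_bcontfun (AS \<mu> h) z - apply_bcontfun (AS \<mu> k) z\<bar> \<le> \<bar>smin \<mu> h z - smin \<mu> k z\<bar>"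
  using aprox_nonexpansive[of "- smin \<mu> h z" "- smin \<mu> k z"] unfolding AS_eq by linarith

text \<open>The first-order condition of the proximity problem, with \<open>q\<close> minus the new
  potential and \<open>p\<close> minus the softmin. The exponential will reappear as a marginal
  density of the coupling.\<close>

lemma AS_subgradient:
  "conj_subgradient \<phi> (- apply_bcontfun (AS \<mu> h) z)
     (exp ((apply_bcontfun (AS \<mu> h) z - smin \<mu> h z) / \<epsilon>))"
  using aprox_subgradient[of "- smin \<mu> h z"] by (simp add: AS_eq minus_diff_commute)

lemma AS_antimono:
  assumes "AE w in \<mu>. apply_bcontfun h w \<le> apply_bcontfun k w"
  shows "apply_bcontfun (AS \<mu> k) z \<le> apply_bcontfun (AS \<mu> h) z"
  using smin_le[of h k 0 z] assms aprox_mono[of "- smin \<mu> h z" "- smin \<mu> k z"]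
  by (simp add: AS_eq)

text \<open>This turns the almost-everywhere identities coming from rigidity and from optimality
  into identities of continuous functions.\<close>

lemma AS_cong_AE:
  assumes "AE w in \<mu>. apply_bcontfun h w = apply_bcontfun k w"
  shows "AS \<mu> h = AS \<mu> k"
proof (rule bcontfun_eqI, rule antisym)
  fix z
  show "apply_bcontfun (AS \<mu> h) z \<le> apply_bcontfun (AS \<mu> k) z"
    by (rule AS_antimono) (use assms in eventually_elim, simp)
  show "apply_bcontfun (AS \<mu> k) z \<le> apply_bcontfun (AS \<mu> h) z"
    by (rule AS_antimono) (use assms in eventually_elim, simp)
qed

lemma abs_apply_diff_le_dist: "\<bar>apply_bcontfun h z - apply_bcontfun k z\<bar> \<le> dist h k" for h k :: "'a \<Rightarrow>\<^sub>C real"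
  using dist_bounded[of h z k] by (simp add: dist_real_def)

lemma smin_diff_le_dist: "\<bar>smin \<mu> h z - smin \<mu> k z\<bar> \<le> dist h k"
proof -
  have "smin \<mu> k z \<le> smin \<mu> h z + dist h k" "smin \<mu> h z \<le> smin \<mu> k z + dist h k"
    by (intro smin_le AE_I2, use abs_apply_diff_le_dist[of h _ k] in \<open>simp add: abs_le_iff algebra_simps\<close>)+
  then show ?thesis by linarith
qed

lemma AS_nonexpansive: "dist (AS \<mu> h) (AS \<mu> k) \<le> dist h k"
proof (rule dist_bound)
  fix z
  show "dist (apply_bcontfun (AS \<mu> h) z) (apply_bcontfun (AS \<mu> k) z) \<le> dist h k"
    using AS_diff_le[of h z k] smin_diff_le_dist[of h z k] by (simp add: dist_real_def)
qed

text \<open>The proximity operator cannot enlarge differences, so the softmins already differ by at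
  least \<open>d\<close> at \<open>z\<close>, which is the equality case \<open>smin_rigid\<close>.
  The sign of the difference is unknown, hence two alternatives.\<close>

lemma AS_rigid:
  assumes "dist h k \<le> d" "d \<le> \<bar>apply_bcontfun (AS \<mu> h) z - apply_bcontfun (AS \<mu> k) z\<bar>"
  shows "(AE w in \<mu>. apply_bcontfun h w = apply_bcontfun k w + d) \<or>
    (AE w in \<mu>. apply_bcontfun k w = apply_bcontfun h w + d)"
proof -
  have hk: "apply_bcontfun h w \<le> apply_bcontfun k w + d" "apply_bcontfun k w \<le> apply_bcontfun h w + d" for w
    using abs_apply_diff_le_dist[of h w k] assms(1) by auto
  have "d \<le> \<bar>smin \<mu> h z - smin \<mu> k z\<bar>" using assms(2) AS_diff_le[of h z k] by linarith
  then consider "smin \<mu> h z + d \<le> smin \<mu> k z" | "smin \<mu> k z + d \<le> smin \<mu> h z" by linarith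
  then show ?thesis using smin_rigid[of h k d z] smin_rigid[of k h d z] hk by cases auto
qed

end

end

subsection \<open>Convergence of orbits\<close>

text \<open>Rigidity needs the extremal difference at an actual point; compactness provides
  it.\<close>

lemma dist_attained:
  fixes h k :: "'a::metric_space \<Rightarrow>\<^sub>C real"
  assumes "compact (UNIV :: 'a set)"
  obtains z where "dist h k = \<bar>apply_bcontfun h z - apply_bcontfun k z\<bar>"
proof -
  have "continuous_on UNIV (\<lambda>z. \<bar>apply_bcontfun h z - apply_bcontfun k z\<bar>)"
    by (intro continuous_intros) auto
  from continuous_attains_sup[OF assms _ this] obtain z
    where z: "\<And>y. \<bar>apply_bcontfun h y - apply_bcontfun k y\<bar> \<le> \<bar>apply_bcontfun h z - apply_bcontfun k z\<bar>"
    by auto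
  have "dist h k = \<bar>apply_bcontfun h z - apply_bcontfun k z\<bar>"
    using z dist_bounded[of h z k] by (intro antisym dist_bound) (auto simp: dist_real_def)
  then show ?thesis using that by blast
qed

lemma tendsto_apply_bcontfun:
  assumes "(F \<longlongrightarrow> f) net"
  shows "((\<lambda>n. apply_bcontfun (F n) x) \<longlongrightarrow> apply_bcontfun f x) net"
proof -
  have "((\<lambda>n. dist (F n) f) \<longlongrightarrow> 0) net" using assms tendsto_dist_iff by blast
  then have "((\<lambda>n. dist (apply_bcontfun (F n) x) (apply_bcontfun f x)) \<longlongrightarrow> 0) net"
    by (rule Lim_null_comparison[rotated]) (simp add: dist_bounded)
  then show ?thesis using tendsto_dist_iff by blast
qed

text \<open>Arzela-Ascoli through total boundedness. A function is encoded by its rounded values on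
  a finite net of the space; there are finitely many codes, and one representative per code forms
  the required net of functions.\<close>

lemma compact_lipschitz_bounded:
  fixes L M :: real
  assumes "compact (UNIV :: 'a::metric_space set)" "0 \<le> L"
  shows "compact {h :: 'a \<Rightarrow>\<^sub>C real. (\<forall>x y. \<bar>apply_bcontfun h x - apply_bcontfun h y\<bar> \<le> L * dist x y) \<and>
     (\<forall>x. \<bar>apply_bcontfun h x\<bar> \<le> M)}" (is "compact ?S")
  unfolding compact_eq_totally_bounded
proof (intro conjI allI impI)
  have "closed ?S"
    unfolding closed_sequential_limits
  proof (intro allI impI)
    fix F :: "nat \<Rightarrow> 'a \<Rightarrow>\<^sub>C real" and f assume F: "(\<forall>n. F n \<in> ?S) \<and> F \<longlonglongrightarrow> f"
    have lim: "(\<lambda>n. apply_bcontfun (F n) x) \<longlonglongrightarrow> apply_bcontfun f x" for x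
      using F tendsto_apply_bcontfun by blast
    have "\<bar>apply_bcontfun f x - apply_bcontfun f y\<bar> \<le> L * dist x y" for x y
      by (rule LIMSEQ_le_const2[OF tendsto_rabs[OF tendsto_diff[OF lim lim]]]) (use F in auto)
    moreover have "\<bar>apply_bcontfun f x\<bar> \<le> M" for x
      by (rule LIMSEQ_le_const2[OF tendsto_rabs[OF lim]]) (use F in auto)
    ultimately show "f \<in> ?S" by blast
  qed
  then show "complete ?S" by (simp add: complete_eq_closed)
next
  fix e :: real assume e: "0 < e"
  \<comment> \<open>Two Lipschitz moves to the nearest net point and one rounding cost
    \<open>e / 4\<close> each, in total less than \<open>e\<close>. Dividing by \<open>L + 1\<close>
    also covers \<open>L = 0\<close>.\<close>
  define \<delta> where "\<delta> = e / 4 / (L + 1)"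
  define \<eta> where "\<eta> = e / 4"
  have pos: "0 < \<delta>" "0 < \<eta>" using e assms(2) by (auto simp: \<delta>_def \<eta>_def)
  have L\<delta>: "L * \<delta> \<le> e / 4"
  proof -
    have "L * \<delta> \<le> (L + 1) * \<delta>" using pos by (simp add: algebra_simps)
    also have "\<dots> = e / 4"
      using assms(2) nonzero_mult_div_cancel_left[of "L + 1" "e / 4"] by (simp add: \<delta>_def del: divide_divide_eq_left)
    finally show ?thesis .
  qed
  obtain k :: "'a set" where k: "finite k" "UNIV \<subseteq> (\<Union>x\<in>k. ball x \<delta>)"
    using assms(1) pos(1) unfolding compact_eq_totally_bounded by blast
  define code where "code h = restrict (\<lambda>x. \<lfloor>apply_bcontfun h x / \<eta>\<rfloor>) k" for h :: "'a \<Rightarrow>\<^sub>C real"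
  have "code ` ?S \<subseteq> PiE k (\<lambda>_. {\<lfloor>- M / \<eta>\<rfloor>..\<lfloor>M / \<eta>\<rfloor>})"
  proof -
    have "- M / \<eta> \<le> apply_bcontfun h x / \<eta>" "apply_bcontfun h x / \<eta> \<le> M / \<eta>"
      if "h \<in> ?S" for h :: "'a \<Rightarrow>\<^sub>C real" and x
    proof -
      have "- M \<le> apply_bcontfun h x" "apply_bcontfun h x \<le> M" using that by (auto simp: abs_le_iff minus_le_iff)
      then show "- M / \<eta> \<le> apply_bcontfun h x / \<eta>" "apply_bcontfun h x / \<eta> \<le> M / \<eta>"
        using pos(2) by (auto intro!: divide_right_mono simp del: divide_minus_left)
    qed
    then show ?thesis unfolding code_def by (intro image_subsetI restrict_PiE_iff[THEN iffD2]) (auto intro!: floor_mono)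
  qed
  then have fin: "finite (code ` ?S)"
    by (rule finite_subset) (intro finite_PiE k finite_atLeastAtMost_int)
  define net where "net = inv_into ?S code ` code ` ?S"
  have "?S \<subseteq> (\<Union>x\<in>net. ball x e)"
  proof
    fix h assume h: "h \<in> ?S"
    define g where "g = inv_into ?S code (code h)"
    have g: "g \<in> ?S" "code g = code h"
      unfolding g_def by (intro inv_into_into f_inv_into_f imageI h)+
    have close: "\<bar>apply_bcontfun g x - apply_bcontfun h x\<bar> \<le> \<eta>" if "x \<in> k" for x
    proof -
      have "\<lfloor>apply_bcontfun g x / \<eta>\<rfloor> = \<lfloor>apply_bcontfun h x / \<eta>\<rfloor>"
        using fun_cong[OF g(2), of x] that by (simp add: code_def)
      then have "\<bar>apply_bcontfun g x / \<eta> - apply_bcontfun h x / \<eta>\<bar> \<le> 1" by linarith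
      then show ?thesis using pos(2) by (simp add: diff_divide_distrib[symmetric] abs_divide)
    qed
    have "dist g h \<le> 3 * e / 4"
    proof (rule dist_bound)
      fix z
      obtain x where x: "x \<in> k" "dist x z < \<delta>" using subsetD[OF k(2) UNIV_I[of z]] by auto
      have "L * dist x z \<le> e / 4"
        using mult_left_mono[of "dist x z" \<delta> L] x(2) assms(2) L\<delta> by linarith
      moreover have "\<bar>apply_bcontfun g x - apply_bcontfun g z\<bar> \<le> L * dist x z"
        "\<bar>apply_bcontfun h x - apply_bcontfun h z\<bar> \<le> L * dist x z" using g(1) h by auto
      ultimately show "dist (apply_bcontfun g z) (apply_bcontfun h z) \<le> 3 * e / 4"
        using close[OF x(1)] unfolding dist_real_def \<eta>_def by linarith
    qed
    then have "h \<in> ball g e" using e by simp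
    then show "h \<in> (\<Union>x\<in>net. ball x e)" unfolding net_def g_def using h by blast
  qed
  then show "\<exists>k. finite k \<and> ?S \<subseteq> (\<Union>x\<in>k. ball x e)" using fin unfolding net_def by blast
qed

section \<open>The full sweep, its rigidity and its orbits\<close>

locale sinkhorn_pair = sinkhorn \<phi> \<epsilon> C \<gamma>
  for \<phi> \<epsilon> and C :: "'a::metric_space \<Rightarrow> 'a \<Rightarrow> real" and \<gamma> +
  fixes \<alpha> \<beta> :: "'a measure"
  assumes \<alpha>: "nonzero_finite_borel \<alpha>" and \<beta>: "nonzero_finite_borel \<beta>"
begin

definition T :: "('a \<Rightarrow>\<^sub>C real) \<Rightarrow> 'a \<Rightarrow>\<^sub>C real" where "T g = AS \<alpha> (AS \<beta> g)"

lemma T_nonexpansive: "dist (T g) (T h) \<le> dist g h"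
  unfolding T_def using AS_nonexpansive[OF \<alpha>] AS_nonexpansive[OF \<beta>] order_trans by blast

lemma T_lipschitz: "\<bar>apply_bcontfun (T h) x - apply_bcontfun (T h) y\<bar> \<le> \<gamma> * dist x y"
  unfolding T_def by (rule AS_lipschitz[OF \<alpha>])

lemma nonexpansive_tendsto:
  assumes "\<And>g h :: 'a \<Rightarrow>\<^sub>C real. dist (U g) (U h) \<le> dist g h" "F \<longlonglongrightarrow> f"
  shows "(\<lambda>n. U (F n) :: 'a \<Rightarrow>\<^sub>C real) \<longlonglongrightarrow> U f"
proof -
  have "(\<lambda>n. dist (F n) f) \<longlonglongrightarrow> 0" using assms(2) tendsto_dist_iff by blast
  then have "(\<lambda>n. dist (U (F n)) (U f)) \<longlonglongrightarrow> 0"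
    by (rule Lim_null_comparison[rotated]) (use assms(1) in auto)
  then show ?thesis using tendsto_dist_iff by blast
qed

lemmas T_tendsto = nonexpansive_tendsto[of T, OF T_nonexpansive]

lemma T_mono:
  assumes "AE w in \<beta>. apply_bcontfun g w \<le> apply_bcontfun h w"
  shows "apply_bcontfun (T g) z \<le> apply_bcontfun (T h) z"
  unfolding T_def by (intro AS_antimono[OF \<alpha>] AE_I2 AS_antimono[OF \<beta>] assms)

text \<open>Excludes one of the two signs left open by rigidity once the order of the functions is
  known.\<close>

lemma not_AE_shift:
  fixes u v :: "'a \<Rightarrow> real"
  assumes "nonzero_finite_borel \<mu>" "0 < d" "\<And>w. u w \<le> v w"
  shows "\<not> (AE w in \<mu>. u w = v w + d)"
proof
  assume "AE w in \<mu>. u w = v w + d"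
  then have "AE w in \<mu>. False"
  proof eventually_elim
    case (elim w)
    then show False using assms(2) assms(3)[of w] by simp
  qed
  then show False using nonzero_finite_borelD(4)[OF assms(1)] by blast
qed

text \<open>Rigidity is traced backwards through the sweep: the distance is attained after the
  \<alpha> half-step, so its inputs differ by \<open>d\<close> almost everywhere for \<alpha>. As
  \<alpha> is nonzero this happens at some point, from which the \<beta> half-step is treated in the
  same way.\<close>

lemma T_rigid:
  assumes "T p = p" "dist h p = d" "dist (T h) p = d"
  shows "(AE w in \<beta>. apply_bcontfun h w = apply_bcontfun p w + d) \<or>
    (AE w in \<beta>. apply_bcontfun p w = apply_bcontfun h w + d)"
proof -
  obtain z where "dist (T h) (T p) = \<bar>apply_bcontfun (T h) z - apply_bcontfun (T p) z\<bar>"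
    using dist_attained[OF compact_UNIV] by blast
  then have "d \<le> \<bar>apply_bcontfun (AS \<alpha> (AS \<beta> h)) z - apply_bcontfun (AS \<alpha> (AS \<beta> p)) z\<bar>"
    using assms by (simp add: T_def)
  moreover have "dist (AS \<beta> h) (AS \<beta> p) \<le> d" using AS_nonexpansive[OF \<beta>] assms(2) by blast
  ultimately have *: "(AE w in \<alpha>. apply_bcontfun (AS \<beta> h) w = apply_bcontfun (AS \<beta> p) w + d) \<or>
      (AE w in \<alpha>. apply_bcontfun (AS \<beta> p) w = apply_bcontfun (AS \<beta> h) w + d)"
    by (intro AS_rigid[OF \<alpha>])
  have "\<exists>w. d \<le> \<bar>apply_bcontfun (AS \<beta> h) w - apply_bcontfun (AS \<beta> p) w\<bar>"
  proof (rule ccontr)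
    assume "\<not> ?thesis"
    then have "\<bar>apply_bcontfun (AS \<beta> h) w - apply_bcontfun (AS \<beta> p) w\<bar> < d" for w
      by (simp add: not_le)
    then have "\<not> (apply_bcontfun (AS \<beta> h) w = apply_bcontfun (AS \<beta> p) w + d)"
      "\<not> (apply_bcontfun (AS \<beta> p) w = apply_bcontfun (AS \<beta> h) w + d)" for w
      by (smt (verit))+
    then show False using * nonzero_finite_borelD(4)[OF \<alpha>] by simp
  qed
  then obtain w where "d \<le> \<bar>apply_bcontfun (AS \<beta> h) w - apply_bcontfun (AS \<beta> p) w\<bar>" by blast
  then show ?thesis by (rule AS_rigid[OF \<beta>, rotated]) (simp add: assms(2))
qed

text \<open>A cluster point \<open>h\<close> and all its images under \<open>T\<close> lie at the same distance from a fixed point,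
  so by rigidity \<open>h\<close> and \<open>T h\<close> are the same vertical shift of it almost everywhere.\<close>

lemma T_cluster_fixed:
  assumes p: "T p = p" and d: "dist h p = d" "dist (T h) p = d" "dist (T (T h)) p = d"
  shows "T (T h) = T h"
proof (cases "d = 0")
  case True
  then show ?thesis using p d by auto
next
  case False
  then have "0 < d" using d(1) zero_le_dist[of h p] by linarith
  have "AE w in \<beta>. apply_bcontfun (T h) w = apply_bcontfun h w"
    using T_rigid[OF p d(1,2)]
  proof
    assume h: "AE w in \<beta>. apply_bcontfun h w = apply_bcontfun p w + d"
    \<comment> \<open>The sweep is monotone, so \<open>T h\<close> stays above the fixed point and
      the shift keeps its sign.\<close>
    have "apply_bcontfun (T p) z \<le> apply_bcontfun (T h) z" for z
    proof (rule T_mono)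
      show "AE w in \<beta>. apply_bcontfun p w \<le> apply_bcontfun h w"
        using h by eventually_elim (use \<open>0 < d\<close> in simp)
    qed
    then have "\<not> (AE w in \<beta>. apply_bcontfun p w = apply_bcontfun (T h) w + d)"
      using not_AE_shift[OF \<beta> \<open>0 < d\<close>] p by metis
    then have "AE w in \<beta>. apply_bcontfun (T h) w = apply_bcontfun p w + d"
      using T_rigid[OF p d(2,3)] by blast
    with h show ?thesis by eventually_elim simp
  next
    assume h: "AE w in \<beta>. apply_bcontfun p w = apply_bcontfun h w + d"
    have "apply_bcontfun (T h) z \<le> apply_bcontfun (T p) z" for z
    proof (rule T_mono)
      show "AE w in \<beta>. apply_bcontfun h w \<le> apply_bcontfun p w"
        using h by eventually_elim (use \<open>0 < d\<close> in simp)
    qed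
    then have "\<not> (AE w in \<beta>. apply_bcontfun (T h) w = apply_bcontfun p w + d)"
      using not_AE_shift[OF \<beta> \<open>0 < d\<close>] p by metis
    then have "AE w in \<beta>. apply_bcontfun p w = apply_bcontfun (T h) w + d"
      using T_rigid[OF p d(2,3)] by blast
    with h show ?thesis by eventually_elim simp
  qed
  \<comment> \<open>\<open>T h\<close> and \<open>h\<close> agree only up to a null set of \<beta>;
    the next half-step removes the exception. Hence the fixed point is \<open>T h\<close> and not
    \<open>h\<close>.\<close>
  then have "AS \<beta> (T h) = AS \<beta> h" by (rule AS_cong_AE[OF \<beta>])
  then show ?thesis by (simp add: T_def)
qed

text \<open>Stated for images of an arbitrary sequence, so that it serves both orbits and discounted
  fixed points.\<close>

lemma T_subsequence:
  fixes F :: "nat \<Rightarrow> 'a \<Rightarrow>\<^sub>C real"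
  assumes "\<And>n x. \<bar>apply_bcontfun (T (F n)) x\<bar> \<le> M"
  obtains l r where "strict_mono r" "(\<lambda>n. T (F (r n))) \<longlonglongrightarrow> l"
proof -
  have "\<forall>n. T (F n) \<in> {h. (\<forall>x y. \<bar>apply_bcontfun h x - apply_bcontfun h y\<bar> \<le> \<gamma> * dist x y) \<and>
     (\<forall>x. \<bar>apply_bcontfun h x\<bar> \<le> M)}"
    using assms T_lipschitz by blast
  from compact_lipschitz_bounded[OF compact_UNIV \<gamma>_nonneg, of M, unfolded compact_def, rule_format,
      of "\<lambda>n. T (F n)", OF this[rule_format]]
  show ?thesis using that by (auto simp: o_def)
qed

lemma orbit_dist_decseq:
  assumes "T p = p" "\<And>t. G (Suc t) = T (G t)"
  shows "decseq (\<lambda>t. dist (G t) p)"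
proof (rule decseq_SucI)
  show "dist (G (Suc t)) p \<le> dist (G t) p" for t
    using T_nonexpansive[of "G t" p] unfolding assms .
qed

lemma orbit_dist_convergent:
  assumes "T p = p" "\<And>t. G (Suc t) = T (G t)"
  obtains d where "(\<lambda>t. dist (G t) p) \<longlonglongrightarrow> d"
proof -
  have "\<forall>t. 0 \<le> dist (G t) p" by simp
  from decseq_convergent[OF orbit_dist_decseq[of p G, OF assms] this] show ?thesis using that by metis
qed

text \<open>Fejer monotonicity: distances to a fixed point decrease along the orbit, so the
  successive cluster points \<open>h\<close>, \<open>T h\<close>, \<open>T (T h)\<close> are equally
  far from \<open>p\<close>. Once \<open>T h\<close> is known to be fixed, the distance to it
  converges as well, and a subsequence identifies its limit as 0.\<close>

lemma orbit_converges:
  assumes p: "T p = p" and G: "\<And>t. G (Suc t) = T (G t)"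
  obtains q where "T q = q" "G \<longlonglongrightarrow> q"
proof -
  have "\<bar>apply_bcontfun (T (G t)) x\<bar> \<le> norm p + dist (G 0) p" for t x
  proof -
    have "dist (G (Suc t)) p \<le> dist (G 0) p"
      by (rule decseqD[OF orbit_dist_decseq[of p G, OF assms] le0])
    moreover have "norm (apply_bcontfun (G (Suc t)) x) \<le> norm (G (Suc t))" by (rule norm_bounded)
    ultimately show ?thesis
      using norm_triangle_sub[of "G (Suc t)" p] by (simp add: dist_norm G)
  qed
  from T_subsequence[of G, OF this]
  obtain h r where r: "strict_mono r" "(\<lambda>n. T (G (r n))) \<longlonglongrightarrow> h" .
  obtain d where d: "(\<lambda>t. dist (G t) p) \<longlonglongrightarrow> d" by (rule orbit_dist_convergent[of p G, OF assms])
  have sub: "strict_mono (\<lambda>n. r n + i)" for i using r(1) by (simp add: strict_mono_def)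
  have dist_eq: "dist k p = d" if "(\<lambda>n. G (r n + i)) \<longlonglongrightarrow> k" for k i
  proof (rule LIMSEQ_unique)
    show "(\<lambda>n. dist (G (r n + i)) p) \<longlonglongrightarrow> dist k p"
      by (rule tendsto_dist[OF that tendsto_const])
    show "(\<lambda>n. dist (G (r n + i)) p) \<longlonglongrightarrow> d"
      using LIMSEQ_subseq_LIMSEQ[OF d sub[of i]] by (simp add: o_def)
  qed
  have 1: "(\<lambda>n. G (r n + 1)) \<longlonglongrightarrow> h" using r(2) by (simp add: G)
  have 2: "(\<lambda>n. G (r n + 2)) \<longlonglongrightarrow> T h" using T_tendsto[OF r(2)] by (simp add: G numeral_2_eq_2)
  have 3: "(\<lambda>n. G (r n + 3)) \<longlonglongrightarrow> T (T h)"
    using T_tendsto[OF T_tendsto[OF r(2)]] by (simp add: G numeral_3_eq_3)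
  have q: "T (T h) = T h"
    by (rule T_cluster_fixed[OF p dist_eq[OF 1] dist_eq[OF 2] dist_eq[OF 3]])
  obtain e where e: "(\<lambda>t. dist (G t) (T h)) \<longlonglongrightarrow> e" by (rule orbit_dist_convergent[of "T h" G, OF q G])
  have "(\<lambda>n. dist (G (r n + 2)) (T h)) \<longlonglongrightarrow> 0" by (rule iffD1[OF tendsto_dist_iff 2])
  moreover have "(\<lambda>n. dist (G (r n + 2)) (T h)) \<longlonglongrightarrow> e"
    using LIMSEQ_subseq_LIMSEQ[OF e sub[of 2]] by (simp add: o_def)
  ultimately have "e = 0" by (rule LIMSEQ_unique[symmetric])
  then have "G \<longlonglongrightarrow> T h" using iffD2[OF tendsto_dist_iff, of G] e by simp
  then show ?thesis using that q by blast
qed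

text \<open>Each discounted sweep contracts with factor \<open>r\<close>, so Banach applies; the
  uniform bound and the common Lipschitz constant give a limit point as the discount
  vanishes.\<close>

lemma fixed_point_of_discounted:
  assumes "\<And>r g z. 0 < r \<Longrightarrow> r < 1 \<Longrightarrow> T (r *\<^sub>R g) = g \<Longrightarrow> \<bar>apply_bcontfun g z\<bar> \<le> M"
  obtains p where "T p = p"
proof -
  \<comment> \<open>Starting at 1/2, these discounts lie strictly between 0 and 1 for every
    index.\<close>
  define r where "r n = 1 - inverse (real n + 2)" for n
  have r: "0 < r n" "r n < 1" for n by (auto simp: r_def field_simps)
  have "\<exists>g. T (r n *\<^sub>R g) = g" for n
  proof -
    have "dist (T (r n *\<^sub>R g)) (T (r n *\<^sub>R h)) \<le> r n * dist g h" for g h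
    proof -
      have "r n *\<^sub>R g - r n *\<^sub>R h = r n *\<^sub>R (g - h)" by (rule scaleR_diff_right[symmetric])
      then show ?thesis
        using T_nonexpansive[of "r n *\<^sub>R g" "r n *\<^sub>R h"] r(1)[of n] by (simp add: dist_norm)
    qed
    then show ?thesis
      using banach_fix_type[of "r n" "\<lambda>g. T (r n *\<^sub>R g)"] r[of n] by (auto simp: less_imp_le)
  qed
  then obtain g where g: "\<And>n. T (r n *\<^sub>R g n) = g n" by metis
  have "\<bar>apply_bcontfun (T (r n *\<^sub>R g n)) x\<bar> \<le> M" for n x using assms[OF r(1) r(2) g] by (simp add: g)
  then obtain l s where s: "strict_mono s" "(\<lambda>n. T (r (s n) *\<^sub>R g (s n))) \<longlonglongrightarrow> l"
    by (rule T_subsequence)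
  then have gl: "(\<lambda>n. g (s n)) \<longlonglongrightarrow> l" by (simp add: g)
  have "(\<lambda>n. inverse (real n + 2)) \<longlonglongrightarrow> 0"
    using LIMSEQ_ignore_initial_segment[OF LIMSEQ_inverse_real_of_nat, of 1] by (simp add: algebra_simps)
  then have "r \<longlonglongrightarrow> 1 - 0" unfolding r_def by (intro tendsto_intros)
  then have "(\<lambda>n. r (s n)) \<longlonglongrightarrow> 1"
    using LIMSEQ_subseq_LIMSEQ[OF _ s(1), of r 1] by (simp add: o_def)
  then have "(\<lambda>n. r (s n) *\<^sub>R g (s n)) \<longlonglongrightarrow> 1 *\<^sub>R l" using gl by (intro tendsto_scaleR)
  then have "(\<lambda>n. T (r (s n) *\<^sub>R g (s n))) \<longlonglongrightarrow> T l" using T_tendsto by simp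
  then have "T l = l" using s(2) LIMSEQ_unique by blast
  then show ?thesis using that by blast
qed

end

subsection \<open>The dual functional\<close>

lemma ereal_integral_mono:
  assumes "\<And>x. h x \<le> k x"
  shows "ereal_integral \<mu> h \<le> ereal_integral \<mu> k"
  unfolding ereal_integral_def
  by (intro ereal_minus_mono less_eq_ennreal.rep_eq[THEN iffD1] nn_integral_mono e2ennreal_mono assms)
    (simp_all add: assms)

lemma ereal_integral_real:
  assumes "integrable \<mu> v"
  shows "ereal_integral \<mu> (\<lambda>x. ereal (v x)) = ereal (integral\<^sup>L \<mu> v)"
proof -
  have "(\<integral>\<^sup>+ x. ennreal (v x) \<partial>\<mu>) \<noteq> \<infinity>" "(\<integral>\<^sup>+ x. ennreal (- v x) \<partial>\<mu>) \<noteq> \<infinity>"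
    using assms by (auto simp: real_integrable_def)
  then obtain p q where "(\<integral>\<^sup>+ x. ennreal (v x) \<partial>\<mu>) = ennreal p" "0 \<le> p"
    "(\<integral>\<^sup>+ x. ennreal (- v x) \<partial>\<mu>) = ennreal q" "0 \<le> q"
    by (metis ennreal_cases infinity_ennreal_def)
  then show ?thesis
    unfolding ereal_integral_def real_lebesgue_integral_def[OF assms] by simp
qed

text \<open>Squaring the weak inequality at \<open>x / 2\<close> makes it strict, since
  \<open>(1 + x / 2)\<^sup>2\<close> exceeds \<open>1 + x\<close> by \<open>x\<^sup>2 / 4\<close>.
  It settles the equality case in \<open>AS_gap\<close>.\<close>

lemma one_plus_less_exp: "x \<noteq> 0 \<Longrightarrow> 1 + x < exp x" for x :: real
proof (cases "-1 \<le> x / 2")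
  case True
  assume "x \<noteq> 0"
  then have "0 < x * x" using not_real_square_gt_zero by blast
  then have "1 + x < (1 + x / 2)\<^sup>2" by (simp add: power2_eq_square field_simps)
  also have "\<dots> \<le> (exp (x / 2))\<^sup>2" using True exp_ge_add_one_self[of "x / 2"] by (intro power_mono) auto
  finally show ?thesis by (simp add: exp_double[symmetric])
next
  case False
  then show ?thesis using exp_gt_zero[of x] by linarith
qed

section \<open>Integration against the coupling\<close>

context sinkhorn_pair
begin

text \<open>Fubini needs measurability for the product of the two Borel algebras. Compactness yields
  a countable dense set, and the inf-convolution formula for Lipschitz functions then writes the
  cost as a countable infimum of sums of functions of one variable.\<close>

lemma C_measurable: "(\<lambda>(x, y). C x y) \<in> borel_measurable (borel \<Otimes>\<^sub>M borel)"
proof -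
  have "\<exists>k. finite k \<and> (UNIV :: 'a set) \<subseteq> (\<Union>x\<in>k. ball x (inverse (real (Suc n))))" for n
    using compact_UNIV unfolding compact_eq_totally_bounded by simp
  then obtain k :: "nat \<Rightarrow> 'a set"
    where k: "\<And>n. finite (k n)" "\<And>n. UNIV \<subseteq> (\<Union>x\<in>k n. ball x (inverse (real (Suc n))))" by metis
  define D where "D = (\<Union>n. k n)"
  have D: "countable D" unfolding D_def using k(1) by (auto intro: countable_finite)
  have dense: "\<exists>z\<in>D. dist x z < e" if e: "0 < e" for x e
  proof -
    obtain n where n: "inverse (real (Suc n)) < e" using reals_Archimedean[OF e] by blast
    obtain z where "z \<in> k n" "dist z x < inverse (real (Suc n))"
      using subsetD[OF k(2) UNIV_I[of x]] by auto
    then show ?thesis using n by (auto simp: D_def dist_commute intro!: bexI[of _ z])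
  qed
  have lower: "C x y \<le> C z y + \<gamma> * dist x z" for x y z
    using C_lipschitz[of x y z] by linarith
  have bdd: "bdd_below ((\<lambda>z. C z y + \<gamma> * dist x z) ` D)" for x y
    using lower by (intro bdd_belowI[of _ "C x y"]) auto
  have "D \<noteq> {}" using dense[of 1] by auto
  have C_eq: "C x y = (INF z\<in>D. C z y + \<gamma> * dist x z)" for x y
  proof (rule antisym)
    show "C x y \<le> (INF z\<in>D. C z y + \<gamma> * dist x z)"
      using lower by (intro cINF_greatest \<open>D \<noteq> {}\<close>)
    show "(INF z\<in>D. C z y + \<gamma> * dist x z) \<le> C x y"
    proof (rule field_le_epsilon)
      fix e :: real assume "0 < e"
      \<comment> \<open>Replacing \<open>x\<close> by \<open>z\<close> costs
        \<open>\<gamma> * dist x z\<close> in the cost and as much in the penalty; the added 1 keeps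
        the denominator positive.\<close>
      then have "0 < e / (2 * \<gamma> + 1)" using \<gamma>_nonneg by simp
      from dense[OF this] obtain z where z: "z \<in> D" "dist x z < e / (2 * \<gamma> + 1)" by blast
      have "2 * \<gamma> * dist x z \<le> (2 * \<gamma> + 1) * dist x z" by (intro mult_right_mono) auto
      also have "\<dots> \<le> e" using z(2) \<gamma>_nonneg by (simp add: pos_less_divide_eq mult.commute less_imp_le)
      finally have "C z y + \<gamma> * dist x z \<le> C x y + e" using C_lipschitz[of z y x] by (simp add: dist_commute)
      then show "(INF z\<in>D. C z y + \<gamma> * dist x z) \<le> C x y + e"
        by (rule cINF_lower2[OF bdd z(1)])
    qed
  qed
  have [measurable]: "C z \<in> borel_measurable borel" "(\<lambda>x. dist x z) \<in> borel_measurable borel" for z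
    using C_cont[of z] by (auto intro!: borel_measurable_continuous_onI continuous_intros simp: C_sym[of z])
  have "(\<lambda>p. INF z\<in>D. C z (snd p) + \<gamma> * dist (fst p) z) \<in> borel_measurable (borel \<Otimes>\<^sub>M borel)"
    by (intro borel_measurable_cINF D bdd) measurable
  then show ?thesis unfolding C_eq[symmetric] by (simp add: case_prod_beta)
qed

lemma C_bounded: obtains B where "\<And>x y. \<bar>C x y\<bar> \<le> B"
proof -
  fix x0 :: 'a
  obtain B where B: "\<And>x. \<bar>C x x0\<bar> \<le> B" using bounded_continuous[OF C_cont] by blast
  obtain D where D: "\<And>x y :: 'a. \<gamma> * dist x y \<le> D" using diameter_bound by blast
  have "\<bar>C x y\<bar> \<le> B + D" for x y
    using B[of x] D[of y x0] C_lipschitz2[of x y x0] by linarith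
  then show ?thesis using that by blast
qed

abbreviation kernel :: "('a \<Rightarrow>\<^sub>C real) \<Rightarrow> ('a \<Rightarrow>\<^sub>C real) \<Rightarrow> 'a \<Rightarrow> 'a \<Rightarrow> real" where
  "kernel f g x y \<equiv> exp ((apply_bcontfun f x + apply_bcontfun g y - C x y) / \<epsilon>)"

lemma finite_pair: "finite_measure (\<alpha> \<Otimes>\<^sub>M \<beta>)" and sigma_finite_pair: "pair_sigma_finite \<alpha> \<beta>"
proof -
  interpret a: finite_measure \<alpha> by (rule nonzero_finite_borelD[OF \<alpha>])
  interpret b: finite_measure \<beta> by (rule nonzero_finite_borelD[OF \<beta>])
  show "finite_measure (\<alpha> \<Otimes>\<^sub>M \<beta>)" by (rule finite_measure_pair_measure) unfold_locales
  show "pair_sigma_finite \<alpha> \<beta>" ..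
qed

text \<open>Constant weights 0 and 1 in place of \<open>a\<close> or \<open>b\<close> specialise
  this to the kernel itself and to its pairing with a function of one variable.\<close>

lemma pair_integrable:
  assumes a: "continuous_on UNIV a" and b: "continuous_on UNIV b"
  shows "integrable (\<alpha> \<Otimes>\<^sub>M \<beta>) (\<lambda>(x, y). (a x + b y) * kernel f g x y)"
proof -
  interpret finite_measure "\<alpha> \<Otimes>\<^sub>M \<beta>" by (rule finite_pair)
  have sets: "sets (\<alpha> \<Otimes>\<^sub>M \<beta>) = sets (borel \<Otimes>\<^sub>M borel)"
    by (intro sets_pair_measure_cong nonzero_finite_borelD \<alpha> \<beta>)
  obtain A B Cb where bound: "\<And>x. \<bar>a x\<bar> \<le> A" "\<And>x. \<bar>b x\<bar> \<le> B" "\<And>x y. \<bar>C x y\<bar> \<le> Cb"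
    using bounded_continuous[OF a] bounded_continuous[OF b] C_bounded by metis
  have [measurable]: "a \<in> borel_measurable borel" "b \<in> borel_measurable borel"
    "apply_bcontfun f \<in> borel_measurable borel" "apply_bcontfun g \<in> borel_measurable borel"
    by (auto intro!: borel_measurable_continuous_onI a b)
  note C_measurable[measurable]
  have "(\<lambda>(x, y). (a x + b y) * kernel f g x y) \<in> borel_measurable (borel \<Otimes>\<^sub>M borel)"
    by measurable
  then have "(\<lambda>(x, y). (a x + b y) * kernel f g x y) \<in> borel_measurable (\<alpha> \<Otimes>\<^sub>M \<beta>)"
    using sets by (simp cong: measurable_cong_sets)
  moreover have "\<bar>(a x + b y) * kernel f g x y\<bar> \<le> (A + B) * exp ((norm f + norm g + Cb) / \<epsilon>)" for x y
  proof -
    have "apply_bcontfun f x + apply_bcontfun g y - C x y \<le> norm f + norm g + Cb"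
      using norm_bounded[of f x] norm_bounded[of g y] bound(3)[of x y] by simp
    then have "kernel f g x y \<le> exp ((norm f + norm g + Cb) / \<epsilon>)"
      using eps_pos by (simp add: divide_right_mono)
    moreover have "\<bar>a x + b y\<bar> \<le> A + B" using bound(1)[of x] bound(2)[of y] by linarith
    ultimately show ?thesis unfolding abs_mult by (intro mult_mono) auto
  qed
  ultimately show ?thesis
    by (intro integrable_const_bound[of _ "(A + B) * exp ((norm f + norm g + Cb) / \<epsilon>)"]) auto
qed

text \<open>The inner integral is \<open>exp_smin\<close>. The symmetry of the cost enters because
  the softmin integrates out its first argument, whereas here the second one is integrated.\<close>

lemma pair_integral_fst:
  assumes a: "continuous_on UNIV a"
  shows "(\<integral>(x, y). a x * kernel f g x y \<partial>(\<alpha> \<Otimes>\<^sub>M \<beta>)) = (\<integral>x. a x * exp ((apply_bcontfun f x - smin \<beta> g x) / \<epsilon>) \<partial>\<alpha>)"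
proof -
  interpret pair_sigma_finite \<alpha> \<beta> by (rule sigma_finite_pair)
  have "integrable (\<alpha> \<Otimes>\<^sub>M \<beta>) (\<lambda>(x, y). a x * kernel f g x y)"
    using pair_integrable[OF a continuous_on_const[of _ 0]] by simp
  from integral_fst[OF this] show ?thesis
    by (simp add: exp_smin[OF \<beta>] C_sym)
qed

lemma pair_integral_snd:
  assumes b: "continuous_on UNIV b"
  shows "(\<integral>(x, y). b y * kernel f g x y \<partial>(\<alpha> \<Otimes>\<^sub>M \<beta>)) = (\<integral>y. b y * exp ((apply_bcontfun g y - smin \<alpha> f y) / \<epsilon>) \<partial>\<beta>)"
proof -
  interpret pair_sigma_finite \<alpha> \<beta> by (rule sigma_finite_pair)
  have "integrable (\<alpha> \<Otimes>\<^sub>M \<beta>) (\<lambda>(x, y). b y * kernel f g x y)"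
    using pair_integrable[OF continuous_on_const[of _ 0] b] by simp
  from integral_snd[OF this] show ?thesis
    by (simp add: exp_smin[OF \<alpha>] add.commute)
qed

text \<open>Total mass of the unnormalised plan, computable through either marginal by
  \<open>coupling_fst\<close> and \<open>coupling_snd\<close>.\<close>

definition coupling :: "('a \<Rightarrow>\<^sub>C real) \<Rightarrow> ('a \<Rightarrow>\<^sub>C real) \<Rightarrow> real" where
  "coupling f g = (\<integral>(x, y). kernel f g x y \<partial>(\<alpha> \<Otimes>\<^sub>M \<beta>))"

lemma kernel_integrable: "integrable (\<alpha> \<Otimes>\<^sub>M \<beta>) (\<lambda>(x, y). kernel f g x y)"
  using pair_integrable[OF continuous_on_const[of _ 1] continuous_on_const[of _ 0]] by simp

lemma coupling_fst: "coupling f g = (\<integral>x. exp ((apply_bcontfun f x - smin \<beta> g x) / \<epsilon>) \<partial>\<alpha>)"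
  unfolding coupling_def using pair_integral_fst[OF continuous_on_const[of _ 1]] by simp

lemma coupling_snd: "coupling f g = (\<integral>y. exp ((apply_bcontfun g y - smin \<alpha> f y) / \<epsilon>) \<partial>\<beta>)"
  unfolding coupling_def using pair_integral_snd[OF continuous_on_const[of _ 1]] by simp

text \<open>The tangent inequality of the exponential, integrated: the directional derivative pairs
  the increments of the potentials with the two marginal densities.\<close>

lemma coupling_convex:
  "\<epsilon> * coupling f g
     + (\<integral>x. (apply_bcontfun f' x - apply_bcontfun f x) * exp ((apply_bcontfun f x - smin \<beta> g x) / \<epsilon>) \<partial>\<alpha>)
     + (\<integral>y. (apply_bcontfun g' y - apply_bcontfun g y) * exp ((apply_bcontfun g y - smin \<alpha> f y) / \<epsilon>) \<partial>\<beta>)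
   \<le> \<epsilon> * coupling f' g'"
proof -
  define a b where "a x = apply_bcontfun f' x - apply_bcontfun f x"
    and "b x = apply_bcontfun g' x - apply_bcontfun g x" for x
  have ab: "continuous_on UNIV a" "continuous_on UNIV b"
    unfolding a_def b_def by (intro continuous_intros; simp)+
  have *: "\<epsilon> * kernel f g x y + a x * kernel f g x y + b y * kernel f g x y \<le> \<epsilon> * kernel f' g' x y" for x y
  proof -
    have "kernel f g x y * (1 + (a x + b y) / \<epsilon>) \<le> kernel f g x y * exp ((a x + b y) / \<epsilon>)"
      by (intro mult_left_mono exp_ge_add_one_self) auto
    also have "\<dots> = kernel f' g' x y"
      by (simp add: exp_add[symmetric] add_divide_distrib[symmetric] a_def b_def)
    finally have le: "\<epsilon> * (kernel f g x y * (1 + (a x + b y) / \<epsilon>)) \<le> \<epsilon> * kernel f' g' x y"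
      using eps_pos by simp
    have split: "\<epsilon> * (K * (1 + c / \<epsilon>)) = \<epsilon> * K + K * c" for K c
      using eps_pos by (simp add: distrib_left)
    show ?thesis using le unfolding split by (simp add: algebra_simps)
  qed
  have ints: "integrable (\<alpha> \<Otimes>\<^sub>M \<beta>) (\<lambda>(x, y). a x * kernel f g x y)"
    "integrable (\<alpha> \<Otimes>\<^sub>M \<beta>) (\<lambda>(x, y). b y * kernel f g x y)"
    using pair_integrable[OF ab(1) continuous_on_const[of _ 0]]
      pair_integrable[OF continuous_on_const[of _ 0] ab(2)] by simp_all
  have "(\<integral>p. \<epsilon> * (case p of (x, y) \<Rightarrow> kernel f g x y) + (case p of (x, y) \<Rightarrow> a x * kernel f g x y)
        + (case p of (x, y) \<Rightarrow> b y * kernel f g x y) \<partial>(\<alpha> \<Otimes>\<^sub>M \<beta>))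
      \<le> (\<integral>p. \<epsilon> * (case p of (x, y) \<Rightarrow> kernel f' g' x y) \<partial>(\<alpha> \<Otimes>\<^sub>M \<beta>))"
    using * by (intro integral_mono Bochner_Integration.integrable_add integrable_mult_right
        kernel_integrable ints) auto
  also have "(\<integral>p. \<epsilon> * (case p of (x, y) \<Rightarrow> kernel f g x y) + (case p of (x, y) \<Rightarrow> a x * kernel f g x y)
        + (case p of (x, y) \<Rightarrow> b y * kernel f g x y) \<partial>(\<alpha> \<Otimes>\<^sub>M \<beta>))
      = \<epsilon> * coupling f g + (\<integral>(x, y). a x * kernel f g x y \<partial>(\<alpha> \<Otimes>\<^sub>M \<beta>))
        + (\<integral>(x, y). b y * kernel f g x y \<partial>(\<alpha> \<Otimes>\<^sub>M \<beta>))"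
    using ints kernel_integrable by (simp add: coupling_def)
  finally show ?thesis
    unfolding pair_integral_fst[OF ab(1)] pair_integral_snd[OF ab(2)] by (simp add: coupling_def a_def b_def)
qed

lemma dual_functional_eq:
  "dual_functional \<epsilon> \<phi> C \<alpha> \<beta> f g =
     - ereal_integral \<alpha> (\<lambda>x. conj_fun \<phi> (- apply_bcontfun f x))
     - ereal_integral \<beta> (\<lambda>y. conj_fun \<phi> (- apply_bcontfun g y))
     - ereal (\<epsilon> * (coupling f g - mass \<alpha> * mass \<beta>))"
proof -
  interpret pair_sigma_finite \<alpha> \<beta> by (rule sigma_finite_pair)
  interpret p: finite_measure "\<alpha> \<Otimes>\<^sub>M \<beta>" by (rule finite_pair)
  have one: "integrable (\<alpha> \<Otimes>\<^sub>M \<beta>) (\<lambda>(x, y). 1 :: real)"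
    using p.integrable_const[of "1 :: real"] by (simp add: split_def)
  have "(\<integral>(x, y). 1 \<partial>(\<alpha> \<Otimes>\<^sub>M \<beta>)) = mass \<alpha> * mass \<beta>"
    using integral_fst[OF one] by (simp add: mass_def case_prod_beta mult.commute)
  then have "(\<integral>p. (case p of (x, y) \<Rightarrow> kernel f g x y) - (case p of (x, y) \<Rightarrow> 1) \<partial>(\<alpha> \<Otimes>\<^sub>M \<beta>))
      = coupling f g - mass \<alpha> * mass \<beta>"
    using Bochner_Integration.integral_diff[OF kernel_integrable[of f g] one] by (simp add: coupling_def)
  moreover have "(\<lambda>p. (case p of (x, y) \<Rightarrow> kernel f g x y) - (case p of (x, y) \<Rightarrow> 1)) =
      (\<lambda>(x, y). kernel f g x y - 1)" by auto
  ultimately show ?thesis by (simp add: dual_functional_def)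
qed

end

section \<open>Tangent bounds for the dual functional at half-steps\<close>

context sinkhorn
begin

text \<open>The conjugate may be infinite nearby, so its continuity along the potential is not
  automatic. The subgradients \<open>s\<close> are continuous on a compact space, hence bounded, and
  this makes \<open>u\<close> Lipschitz.\<close>

lemma AS_conj:
  assumes \<mu>: "nonzero_finite_borel \<mu>"
  defines "s \<equiv> \<lambda>g x. exp ((apply_bcontfun (AS \<mu> g) x - smin \<mu> g x) / \<epsilon>)"
  obtains u where "continuous_on UNIV u"
    "\<forall>x. conj_fun \<phi> (- apply_bcontfun (AS \<mu> g) x) = ereal (u x)"
    "\<forall>x r. ereal (u x + s g x * (apply_bcontfun (AS \<mu> g) x - r)) \<le> conj_fun \<phi> (- r)"
proof -
  define f where "f = apply_bcontfun (AS \<mu> g)"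
  have "conj_subgradient \<phi> (- f x) (s g x)" for x
    using AS_subgradient[OF \<mu>] by (simp add: f_def s_def)
  then have "\<exists>v. conj_fun \<phi> (- f x) = ereal v \<and> (\<forall>r. ereal (v + s g x * (r - - f x)) \<le> conj_fun \<phi> r)" for x
    unfolding conj_subgradient_def .
  then obtain u where "\<forall>x. conj_fun \<phi> (- f x) = ereal (u x) \<and>
      (\<forall>r. ereal (u x + s g x * (r - - f x)) \<le> conj_fun \<phi> r)"
    using choice[of "\<lambda>x v. conj_fun \<phi> (- f x) = ereal v \<and> (\<forall>r. ereal (v + s g x * (r - - f x)) \<le> conj_fun \<phi> r)"]
    by blast
  then have u: "conj_fun \<phi> (- f x) = ereal (u x)"
    "ereal (u x + s g x * (r + f x)) \<le> conj_fun \<phi> r" for x r by simp_all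
  have s_cont: "continuous_on UNIV (s g)"
    unfolding s_def by (intro continuous_intros smin_cont[OF \<mu>]) (use eps_pos in auto)
  obtain B where B: "\<And>x. \<bar>s g x\<bar> \<le> B" using bounded_continuous[OF s_cont] by blast
  have B0: "0 \<le> B" using B abs_ge_zero order_trans by blast
  have lip: "u x - u y \<le> B * \<gamma> * dist x y" for x y
  proof -
    have "u x + s g x * (f x - f y) \<le> u y"
      using u(2)[of x "- f y"] u(1)[of y] by (simp add: algebra_simps)
    then have "u x - u y \<le> s g x * (f y - f x)" by (simp add: algebra_simps)
    also have "\<dots> \<le> \<bar>s g x\<bar> * \<bar>f y - f x\<bar>" by (simp add: abs_mult[symmetric])
    also have "\<dots> \<le> B * (\<gamma> * dist x y)"
      using B AS_lipschitz[OF \<mu>, of g y x] B0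
      by (intro mult_mono) (auto simp: f_def dist_commute)
    finally show ?thesis by simp
  qed
  have "\<bar>u x - u y\<bar> \<le> B * \<gamma> * dist x y" for x y
    using lip[of x y] lip[of y x] by (simp add: abs_le_iff dist_commute)
  then have "(B * \<gamma>)-lipschitz_on UNIV u"
    using B0 \<gamma>_nonneg by (intro lipschitz_onI) (simp_all add: dist_real_def)
  then have "continuous_on UNIV u" by (rule lipschitz_on_continuous_on)
  moreover have "ereal (u x + s g x * (f x - r)) \<le> conj_fun \<phi> (- r)" for x r
    using u(2)[of x "- r"] by simp
  ultimately show ?thesis using that u(1) unfolding f_def by blast
qed

text \<open>The minorant \<open>conj_ge_id\<close> is integrable here. The value \<infinity> remains
  possible, but differences in the dual functional never mix the two infinities.\<close>

lemma conj_integral_not_MInfty: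
  fixes f :: "'a \<Rightarrow>\<^sub>C real"
  assumes "nonzero_finite_borel \<mu>"
  shows "ereal_integral \<mu> (\<lambda>x. conj_fun \<phi> (- apply_bcontfun f x)) \<noteq> - \<infinity>"
proof -
  have int: "integrable \<mu> (\<lambda>x. - apply_bcontfun f x)"
    by (intro integrable_continuous[OF assms] continuous_intros) auto
  have "ereal (\<integral>x. - apply_bcontfun f x \<partial>\<mu>) \<le> ereal_integral \<mu> (\<lambda>x. conj_fun \<phi> (- apply_bcontfun f x))"
    unfolding ereal_integral_real[OF int, symmetric] by (rule ereal_integral_mono) (rule conj_ge_id)
  then show ?thesis by auto
qed

end

context sinkhorn_pair
begin

abbreviation dual :: "('a \<Rightarrow>\<^sub>C real) \<Rightarrow> ('a \<Rightarrow>\<^sub>C real) \<Rightarrow> ereal" where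
  "dual \<equiv> dual_functional \<epsilon> \<phi> C \<alpha> \<beta>"

lemma swap: "sinkhorn_pair \<phi> \<epsilon> C \<gamma> \<beta> \<alpha>"
  using \<alpha> \<beta> by unfold_locales

text \<open>With a symmetric cost, exchanging the measures and potentials is a symmetry of the
  problem, so optimality has to be analysed for one half-step only.\<close>

lemma dual_swap: "dual f g = dual_functional \<epsilon> \<phi> C \<beta> \<alpha> g f"
proof -
  interpret swap: sinkhorn_pair \<phi> \<epsilon> C \<gamma> \<beta> \<alpha> by (rule swap)
  have "swap.coupling g f = coupling f g" by (simp add: coupling_fst swap.coupling_snd)
  then show ?thesis
    unfolding dual_functional_eq swap.dual_functional_eq
    by (simp add: minus_ereal_def mult.commute add.commute)
qed

lemma optimal_swap:
  "optimal_potentials \<epsilon> \<phi> C \<alpha> \<beta> f g \<longleftrightarrow> optimal_potentials \<epsilon> \<phi> C \<beta> \<alpha> g f"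
  unfolding optimal_potentials_def dual_swap by blast

text \<open>\<open>gibbs \<beta> f g\<close> is the density with respect to \<open>\<alpha>\<close> of the first marginal of the coupling
  \<open>e\<^bsup>(f \<oplus> g - C)/\<epsilon>\<^esup> \<alpha> \<otimes> \<beta>\<close>; likewise \<open>gibbs \<alpha> g f\<close> for the second one.\<close>

abbreviation gibbs :: "'a measure \<Rightarrow> ('a \<Rightarrow>\<^sub>C real) \<Rightarrow> ('a \<Rightarrow>\<^sub>C real) \<Rightarrow> 'a \<Rightarrow> real" where
  "gibbs \<mu> f g x \<equiv> exp ((apply_bcontfun f x - smin \<mu> g x) / \<epsilon>)"

lemma gibbs_cont: "nonzero_finite_borel \<mu> \<Longrightarrow> continuous_on UNIV (gibbs \<mu> f g)"
  by (intro continuous_intros smin_cont) (use eps_pos in auto)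

text \<open>The pointwise subgradient inequality integrated: a finite value at the half-step and an
  affine minorant touching there.\<close>

lemma conj_integral_AS:
  assumes \<mu>: "nonzero_finite_borel \<mu>" and \<nu>: "nonzero_finite_borel \<nu>"
  obtains a where "ereal_integral \<nu> (\<lambda>x. conj_fun \<phi> (- apply_bcontfun (AS \<mu> k) x)) = ereal a"
    "\<forall>f. ereal (a - (\<integral>x. (apply_bcontfun f x - apply_bcontfun (AS \<mu> k) x) * gibbs \<mu> (AS \<mu> k) k x \<partial>\<nu>))
       \<le> ereal_integral \<nu> (\<lambda>x. conj_fun \<phi> (- apply_bcontfun f x))"
proof -
  from AS_conj[OF \<mu>, of k]
  obtain u where u: "continuous_on UNIV u"
    "\<forall>x. conj_fun \<phi> (- apply_bcontfun (AS \<mu> k) x) = ereal (u x)"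
    "\<forall>x r. ereal (u x + gibbs \<mu> (AS \<mu> k) k x * (apply_bcontfun (AS \<mu> k) x - r)) \<le> conj_fun \<phi> (- r)" .
  have u_int: "integrable \<nu> u" by (rule integrable_continuous[OF \<nu> u(1)])
  show ?thesis
  proof (rule that[of "integral\<^sup>L \<nu> u"])
    show "ereal_integral \<nu> (\<lambda>x. conj_fun \<phi> (- apply_bcontfun (AS \<mu> k) x)) = ereal (integral\<^sup>L \<nu> u)"
      unfolding u(2)[rule_format] by (rule ereal_integral_real[OF u_int])
    show "\<forall>f. ereal (integral\<^sup>L \<nu> u - (\<integral>x. (apply_bcontfun f x - apply_bcontfun (AS \<mu> k) x)
          * gibbs \<mu> (AS \<mu> k) k x \<partial>\<nu>)) \<le> ereal_integral \<nu> (\<lambda>x. conj_fun \<phi> (- apply_bcontfun f x))"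
    proof
      fix f :: "'a \<Rightarrow>\<^sub>C real"
      define w where "w x = (apply_bcontfun f x - apply_bcontfun (AS \<mu> k) x) * gibbs \<mu> (AS \<mu> k) k x" for x
      have w_int: "integrable \<nu> w"
        unfolding w_def by (intro integrable_continuous \<nu> continuous_on_mult gibbs_cont \<mu> continuous_intros) auto
      have le: "ereal (u x - w x) \<le> conj_fun \<phi> (- apply_bcontfun f x)" for x
        using u(3)[rule_format, of x "apply_bcontfun f x"] by (simp add: w_def algebra_simps)
      have "ereal (\<integral>x. u x - w x \<partial>\<nu>) \<le> ereal_integral \<nu> (\<lambda>x. conj_fun \<phi> (- apply_bcontfun f x))"
        unfolding ereal_integral_real[OF Bochner_Integration.integrable_diff[OF u_int w_int], symmetric]
        by (intro ereal_integral_mono le)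
      then show "ereal (integral\<^sup>L \<nu> u - (\<integral>x. (apply_bcontfun f x - apply_bcontfun (AS \<mu> k) x)
            * gibbs \<mu> (AS \<mu> k) k x \<partial>\<nu>)) \<le> ereal_integral \<nu> (\<lambda>x. conj_fun \<phi> (- apply_bcontfun f x))"
        unfolding Bochner_Integration.integral_diff[OF u_int w_int] unfolding w_def .
    qed
  qed
qed

text \<open>Concave tangent bound at \<open>(F, G)\<close>. The two integrals measure the mismatch
  between the potentials \<open>k\<close>, \<open>l\<close> from which \<open>F\<close>,
  \<open>G\<close> were computed and the potentials \<open>G\<close>, \<open>F\<close> actually
  paired with them; both vanish at a fixed point.\<close>

lemma dual_le_AS_pair:
  fixes k l
  defines "F \<equiv> AS \<beta> k" and "G \<equiv> AS \<alpha> l"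
  obtains d where "dual F G = ereal d"
    "\<forall>f g. dual f g \<le> ereal (d
       + (\<integral>x. (apply_bcontfun f x - apply_bcontfun F x)
            * (gibbs \<beta> F k x - gibbs \<beta> F G x) \<partial>\<alpha>)
       + (\<integral>y. (apply_bcontfun g y - apply_bcontfun G y)
            * (gibbs \<alpha> G l y - gibbs \<alpha> G F y) \<partial>\<beta>))"
proof -
  from conj_integral_AS[OF \<beta> \<alpha>, of k, folded F_def]
  obtain a where a: "ereal_integral \<alpha> (\<lambda>x. conj_fun \<phi> (- apply_bcontfun F x)) = ereal a"
    "\<forall>f. ereal (a - (\<integral>x. (apply_bcontfun f x - apply_bcontfun F x) * gibbs \<beta> F k x \<partial>\<alpha>))
       \<le> ereal_integral \<alpha> (\<lambda>x. conj_fun \<phi> (- apply_bcontfun f x))" .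
  from conj_integral_AS[OF \<alpha> \<beta>, of l, folded G_def]
  obtain b where b: "ereal_integral \<beta> (\<lambda>x. conj_fun \<phi> (- apply_bcontfun G x)) = ereal b"
    "\<forall>f. ereal (b - (\<integral>x. (apply_bcontfun f x - apply_bcontfun G x) * gibbs \<alpha> G l x \<partial>\<beta>))
       \<le> ereal_integral \<beta> (\<lambda>x. conj_fun \<phi> (- apply_bcontfun f x))" .
  define c where "c = mass \<alpha> * mass \<beta>"
  define d where "d = - a - b - \<epsilon> * (coupling F G - c)"
  have int: "integrable \<nu> (\<lambda>x. (apply_bcontfun f x - apply_bcontfun f1 x) * gibbs \<mu> f1 f2 x)"
    if "nonzero_finite_borel \<nu>" "nonzero_finite_borel \<mu>" for \<mu> \<nu> and f f1 f2 :: "'a \<Rightarrow>\<^sub>C real"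
    by (intro integrable_continuous that continuous_on_mult gibbs_cont continuous_intros) auto
  have "dual f g \<le> ereal (d
       + (\<integral>x. (apply_bcontfun f x - apply_bcontfun F x) * (gibbs \<beta> F k x - gibbs \<beta> F G x) \<partial>\<alpha>)
       + (\<integral>y. (apply_bcontfun g y - apply_bcontfun G y) * (gibbs \<alpha> G l y - gibbs \<alpha> G F y) \<partial>\<beta>))" for f g
  proof -
    have "dual f g \<le>
        - ereal (a - (\<integral>x. (apply_bcontfun f x - apply_bcontfun F x) * gibbs \<beta> F k x \<partial>\<alpha>))
        - ereal (b - (\<integral>x. (apply_bcontfun g x - apply_bcontfun G x) * gibbs \<alpha> G l x \<partial>\<beta>))
        - ereal (\<epsilon> * (coupling f g - c))"
      unfolding dual_functional_eq c_def
      by (intro ereal_minus_mono ereal_minus_le_minus[THEN iffD2] a(2)[rule_format] b(2)[rule_format] order_refl)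
    also have "\<dots> = ereal (- a + (\<integral>x. (apply_bcontfun f x - apply_bcontfun F x) * gibbs \<beta> F k x \<partial>\<alpha>)
         - b + (\<integral>x. (apply_bcontfun g x - apply_bcontfun G x) * gibbs \<alpha> G l x \<partial>\<beta>)
         - \<epsilon> * (coupling f g - c))" by simp
    also have "\<dots> \<le> ereal (d
       + ((\<integral>x. (apply_bcontfun f x - apply_bcontfun F x) * gibbs \<beta> F k x \<partial>\<alpha>)
          - (\<integral>x. (apply_bcontfun f x - apply_bcontfun F x) * gibbs \<beta> F G x \<partial>\<alpha>))
       + ((\<integral>y. (apply_bcontfun g y - apply_bcontfun G y) * gibbs \<alpha> G l y \<partial>\<beta>)
          - (\<integral>y. (apply_bcontfun g y - apply_bcontfun G y) * gibbs \<alpha> G F y \<partial>\<beta>)))"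
      using coupling_convex[of F G f g] by (simp add: d_def algebra_simps)
    finally show ?thesis
      unfolding right_diff_distrib
      by (simp only: Bochner_Integration.integral_diff[OF int int] \<alpha> \<beta>)
  qed
  moreover have "dual F G = ereal d"
    unfolding dual_functional_eq a(1) b(1) by (simp add: d_def c_def)
  ultimately show ?thesis using that[of d] by blast
qed

lemma fixed_point_optimal:
  assumes "f = AS \<beta> g" "g = AS \<alpha> f"
  shows "optimal_potentials \<epsilon> \<phi> C \<alpha> \<beta> f g"
  unfolding optimal_potentials_def
proof (intro allI)
  fix f1 g1
  from dual_le_AS_pair[of g f]
  obtain d where "dual (AS \<beta> g) (AS \<alpha> f) = ereal d"
    "\<forall>f1 g1. dual f1 g1 \<le> ereal (d
       + (\<integral>x. (apply_bcontfun f1 x - apply_bcontfun (AS \<beta> g) x)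
            * (gibbs \<beta> (AS \<beta> g) g x - gibbs \<beta> (AS \<beta> g) (AS \<alpha> f) x) \<partial>\<alpha>)
       + (\<integral>y. (apply_bcontfun g1 y - apply_bcontfun (AS \<alpha> f) y)
            * (gibbs \<alpha> (AS \<alpha> f) f y - gibbs \<alpha> (AS \<alpha> f) (AS \<beta> g) y) \<partial>\<beta>))" .
  from this[folded assms] show "dual f1 g1 \<le> dual f g" by simp
qed

text \<open>\<open>gap\<close> is the Bregman divergence of the exponential term: with
  \<open>\<delta> = (f - F) / \<epsilon>\<close> it is the density at \<open>F\<close> times
  \<open>\<epsilon> * (exp \<delta> - 1 - \<delta>)\<close>, which vanishes only for
  \<open>\<delta> = 0\<close>.\<close>

lemma AS_gap:
  fixes f g
  defines "gap \<equiv> \<lambda>x. \<epsilon> * gibbs \<beta> f g x - \<epsilon> * gibbs \<beta> (AS \<beta> g) g x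
      - (apply_bcontfun f x - apply_bcontfun (AS \<beta> g) x) * gibbs \<beta> (AS \<beta> g) g x"
  shows "0 \<le> gap x" "gap x = 0 \<Longrightarrow> apply_bcontfun f x = apply_bcontfun (AS \<beta> g) x"
    "integrable \<alpha> gap"
    "integral\<^sup>L \<alpha> gap = \<epsilon> * coupling f g - \<epsilon> * coupling (AS \<beta> g) g
      - (\<integral>x. (apply_bcontfun f x - apply_bcontfun (AS \<beta> g) x) * gibbs \<beta> (AS \<beta> g) g x \<partial>\<alpha>)"
proof -
  define F where "F = AS \<beta> g"
  define \<delta> where "\<delta> = (apply_bcontfun f x - apply_bcontfun F x) / \<epsilon>"
  have "gibbs \<beta> f g x = gibbs \<beta> F g x * exp \<delta>"
    by (simp add: \<delta>_def exp_add[symmetric] add_divide_distrib[symmetric])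
  moreover have "apply_bcontfun f x - apply_bcontfun F x = \<epsilon> * \<delta>" using eps_pos by (simp add: \<delta>_def)
  ultimately have gap: "gap x = \<epsilon> * gibbs \<beta> F g x * (exp \<delta> - (1 + \<delta>))"
    by (simp add: gap_def F_def[symmetric] algebra_simps)
  then show "0 \<le> gap x" using eps_pos exp_ge_add_one_self[of \<delta>] by simp
  assume "gap x = 0"
  then have "\<delta> = 0" using gap eps_pos one_plus_less_exp[of \<delta>] by force
  then show "apply_bcontfun f x = apply_bcontfun (AS \<beta> g) x" using eps_pos by (simp add: \<delta>_def F_def)
next
  have int: "integrable \<alpha> (gibbs \<beta> f1 g)"
    "integrable \<alpha> (\<lambda>x. (apply_bcontfun f x - apply_bcontfun f1 x) * gibbs \<beta> f1 g x)" for f1 :: "'a \<Rightarrow>\<^sub>C real"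
    by (intro integrable_continuous \<alpha> \<beta> continuous_on_mult gibbs_cont continuous_intros; simp)+
  show "integrable \<alpha> gap" unfolding gap_def by (intro Bochner_Integration.integrable_diff integrable_mult_right int)
  show "integral\<^sup>L \<alpha> gap = \<epsilon> * coupling f g - \<epsilon> * coupling (AS \<beta> g) g
      - (\<integral>x. (apply_bcontfun f x - apply_bcontfun (AS \<beta> g) x) * gibbs \<beta> (AS \<beta> g) g x \<partial>\<alpha>)"
    unfolding gap_def coupling_fst using int by simp
qed

text \<open>Block ascent: by the affine minorant at \<open>AS \<beta> g\<close>, passing from
  \<open>f\<close> to it gains at least the integral of the gap. In the equality case
  \<open>dual f g \<noteq> - \<infinity>\<close> makes the conjugate integrals finite, so that they
  can be cancelled.\<close>

lemma AS_improves: "dual f g \<le> dual (AS \<beta> g) g"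
  and AS_improves_eq: "dual (AS \<beta> g) g \<le> dual f g \<Longrightarrow> dual f g \<noteq> - \<infinity> \<Longrightarrow>
    AE x in \<alpha>. apply_bcontfun f x = apply_bcontfun (AS \<beta> g) x"
proof -
  note gap = AS_gap[where f = f and g = g]
  from conj_integral_AS[OF \<beta> \<alpha>, of g]
  obtain a where a: "ereal_integral \<alpha> (\<lambda>x. conj_fun \<phi> (- apply_bcontfun (AS \<beta> g) x)) = ereal a"
    "\<forall>f. ereal (a - (\<integral>x. (apply_bcontfun f x - apply_bcontfun (AS \<beta> g) x) * gibbs \<beta> (AS \<beta> g) g x \<partial>\<alpha>))
       \<le> ereal_integral \<alpha> (\<lambda>x. conj_fun \<phi> (- apply_bcontfun f x))" .
  define w where "w = (\<integral>x. (apply_bcontfun f x - apply_bcontfun (AS \<beta> g) x) * gibbs \<beta> (AS \<beta> g) g x \<partial>\<alpha>)"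
  define A where "A = ereal_integral \<alpha> (\<lambda>x. conj_fun \<phi> (- apply_bcontfun f x))"
  define B where "B = ereal_integral \<beta> (\<lambda>x. conj_fun \<phi> (- apply_bcontfun g x))"
  define c where "c = mass \<alpha> * mass \<beta>"
  have B: "B \<noteq> - \<infinity>" unfolding B_def by (rule conj_integral_not_MInfty[OF \<beta>])
  have A: "ereal (a - w) \<le> A" using a(2) by (auto simp: A_def w_def)
  have dual1: "dual f g = - A - B - ereal (\<epsilon> * (coupling f g - c))"
    and dual2: "dual (AS \<beta> g) g = - ereal a - B - ereal (\<epsilon> * (coupling (AS \<beta> g) g - c))"
    unfolding dual_functional_eq A_def B_def c_def a(1) by simp_all
  define I where "I = \<epsilon> * coupling f g - \<epsilon> * coupling (AS \<beta> g) g - w"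
  have "0 \<le> I" unfolding I_def w_def gap(4)[symmetric] using gap(1) by (intro Bochner_Integration.integral_nonneg)
  then show "dual f g \<le> dual (AS \<beta> g) g"
    unfolding dual1 dual2 using A B by (cases A; cases B) (auto simp: I_def algebra_simps)
  assume "dual (AS \<beta> g) g \<le> dual f g" "dual f g \<noteq> - \<infinity>"
  then have "I \<le> 0"
    unfolding dual1 dual2 using A B by (cases A; cases B) (auto simp: I_def algebra_simps)
  then have "I = 0" using \<open>0 \<le> I\<close> by simp
  then have "AE x in \<alpha>. \<epsilon> * gibbs \<beta> f g x - \<epsilon> * gibbs \<beta> (AS \<beta> g) g x
      - (apply_bcontfun f x - apply_bcontfun (AS \<beta> g) x) * gibbs \<beta> (AS \<beta> g) g x = 0"
    using integral_nonneg_eq_0_iff_AE[OF gap(3)] gap(1) unfolding I_def w_def gap(4)[symmetric] by simp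
  then show "AE x in \<alpha>. apply_bcontfun f x = apply_bcontfun (AS \<beta> g) x"
    by eventually_elim (rule gap(2))
qed

lemma dual_zero: "dual 0 0 \<noteq> - \<infinity>"
proof -
  have "ereal_integral \<mu> (\<lambda>x. 0) = 0" for \<mu> :: "'a measure" by (simp add: ereal_integral_def e2ennreal_neg)
  then show ?thesis by (simp add: dual_functional_eq conj_zero)
qed

lemma optimal_AE:
  assumes "optimal_potentials \<epsilon> \<phi> C \<alpha> \<beta> f g"
  shows "AE x in \<alpha>. apply_bcontfun f x = apply_bcontfun (AS \<beta> g) x"
proof (rule AS_improves_eq)
  show "dual (AS \<beta> g) g \<le> dual f g" using assms by (simp add: optimal_potentials_def)
  have "dual 0 0 \<le> dual f g" using assms by (simp add: optimal_potentials_def)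
  then show "dual f g \<noteq> - \<infinity>" using dual_zero by auto
qed

text \<open>Optimality gives each potential as a half-step of the other almost everywhere only;
  \<open>AS \<alpha> f\<close> is a representative for which the identity is exact.\<close>

lemma optimal_imp_fixed_point:
  assumes "optimal_potentials \<epsilon> \<phi> C \<alpha> \<beta> f g"
  obtains p where "T p = p"
proof -
  interpret swap: sinkhorn_pair \<phi> \<epsilon> C \<gamma> \<beta> \<alpha> by (rule swap)
  have "AS \<alpha> (AS \<beta> g) = AS \<alpha> f"
    using optimal_AE[OF assms] by (intro AS_cong_AE[OF \<alpha>]) (auto simp: eq_commute)
  moreover have "AS \<beta> (AS \<alpha> f) = AS \<beta> g"
    using swap.optimal_AE assms optimal_swap by (intro AS_cong_AE[OF \<beta>]) (auto simp: eq_commute)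
  ultimately have "T (AS \<alpha> f) = AS \<alpha> f" by (simp add: T_def)
  then show ?thesis using that by blast
qed

end

subsection \<open>Existence of optimal potentials and of fixed points\<close>

text \<open>The point 0 tests the subgradient from above, the affine minorant of slope
  \<open>p\<close> from below. Dividing by \<open>q\<close> compares \<open>s\<close> with
  \<open>p\<close> up to \<open>w / \<bar>q\<bar>\<close>; this converts values of \<phi> into
  bounds on subgradients.\<close>

lemma conj_subgradient_ge:
  assumes "conj_subgradient \<phi> q s" "0 \<le> p" "\<phi> p = ereal w" "conj_fun \<phi> 0 = 0"
  shows "p * q - w \<le> s * q"
proof -
  obtain u where u: "conj_fun \<phi> q = ereal u" "ereal (u + s * (0 - q)) \<le> conj_fun \<phi> 0"
    using assms(1) unfolding conj_subgradient_def by blast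
  then show ?thesis using conj_fun_ge[of p q \<phi>] assms by simp
qed

context sinkhorn_pair
begin

text \<open>Pairing \<open>F\<close> with its own half-step kills the second mismatch, so the bound
  does not depend on \<open>g\<close>.\<close>

lemma dual_le_AS_near:
  obtains d M where "dual (AS \<beta> k) (AS \<alpha> (AS \<beta> k)) = ereal d"
    "\<forall>f g. dual f g \<le> ereal (d + dist f (AS \<beta> k) * M)"
proof -
  define F where "F = AS \<beta> k"
  define G where "G = AS \<alpha> F"
  define h where "h x = gibbs \<beta> F k x - gibbs \<beta> F G x" for x
  from dual_le_AS_pair[of k F, folded F_def G_def]
  obtain d where d: "dual F G = ereal d" "\<forall>f g. dual f g \<le> ereal (d
       + (\<integral>x. (apply_bcontfun f x - apply_bcontfun F x)
            * (gibbs \<beta> F k x - gibbs \<beta> F G x) \<partial>\<alpha>)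
       + (\<integral>y. (apply_bcontfun g y - apply_bcontfun G y)
            * (gibbs \<alpha> G F y - gibbs \<alpha> G F y) \<partial>\<beta>))" .
  have h_cont: "continuous_on UNIV h"
    unfolding h_def by (intro continuous_on_diff gibbs_cont \<beta>)
  have "dual f g \<le> ereal (d + dist f F * (\<integral>x. \<bar>h x\<bar> \<partial>\<alpha>))" for f g
  proof -
    have "(\<integral>x. (apply_bcontfun f x - apply_bcontfun F x) * h x \<partial>\<alpha>) \<le> (\<integral>x. dist f F * \<bar>h x\<bar> \<partial>\<alpha>)"
    proof (intro integral_mono integrable_continuous \<alpha> continuous_intros h_cont)
      fix x
      have "(apply_bcontfun f x - apply_bcontfun F x) * h x \<le> \<bar>apply_bcontfun f x - apply_bcontfun F x\<bar> * \<bar>h x\<bar>"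
        by (simp add: abs_mult[symmetric])
      also have "\<dots> \<le> dist f F * \<bar>h x\<bar>"
        using dist_bounded[of f x F] by (intro mult_right_mono) (auto simp: dist_real_def)
      finally show "(apply_bcontfun f x - apply_bcontfun F x) * h x \<le> dist f F * \<bar>h x\<bar>" .
    qed auto
    then have "ereal (d + (\<integral>x. (apply_bcontfun f x - apply_bcontfun F x) * h x \<partial>\<alpha>))
        \<le> ereal (d + dist f F * (\<integral>x. \<bar>h x\<bar> \<partial>\<alpha>))" by simp
    moreover have "dual f g \<le> ereal (d + (\<integral>x. (apply_bcontfun f x - apply_bcontfun F x) * h x \<partial>\<alpha>))"
      using d(2) by (simp add: h_def)
    ultimately show ?thesis by (rule order_trans[rotated])
  qed
  then show ?thesis using that d(1) unfolding F_def G_def by blast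
qed

text \<open>The functional is only upper semicontinuous, but replacing the first components of a maximizing
  sequence by their images under \<open>AS \<beta>\<close> keeps it maximizing and gives control of its limit.\<close>

lemma optimal_potentials_exist:
  assumes "compact K"
    and "(SUP (f, g)\<in>K. dual f g) = (SUP (f, g)\<in>UNIV. dual f g)"
  shows "\<exists>f g. optimal_potentials \<epsilon> \<phi> C \<alpha> \<beta> f g"
proof -
  define D where "D = (\<lambda>(f, g). dual f g)"
  define S where "S = Sup (D ` K)"
  have D_le: "dual f g \<le> S" for f g
  proof -
    have "D (f, g) \<le> Sup (range D)" by (intro Sup_upper) auto
    then show ?thesis using assms(2) by (simp add: D_def S_def)
  qed
  \<comment> \<open>Over an empty set the supremum would be minus infinity, which the pair of zero
    potentials excludes.\<close>
  have "K \<noteq> {}" using D_le[of 0 0] dual_zero by (auto simp: S_def bot_ereal_def)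
  then have "D ` K \<noteq> {}" by simp
  from Sup_countable_SUP[OF this] obtain y where y: "incseq y" "range y \<subseteq> D ` K"
    "Sup (D ` K) = (SUP n::nat. y n)" by blast
  have "\<forall>n. \<exists>k. k \<in> K \<and> y n = D k" using y(2) by blast
  then obtain k where k: "\<forall>n. k n \<in> K" "\<And>n. y n = D (k n)" by metis
  from assms(1)[unfolded compact_def, rule_format, of k] k(1)
  obtain l r where l: "strict_mono r" "(k \<circ> r) \<longlonglongrightarrow> l" by blast
  define f g where "f n = fst (k (r n))" and "g n = snd (k (r n))" for n
  have g_lim: "g \<longlonglongrightarrow> snd l" using tendsto_snd[OF l(2)] by (simp add: g_def[abs_def] o_def)
  have "y \<longlonglongrightarrow> S" using LIMSEQ_SUP[OF y(1)] y(3) by (simp add: S_def)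
  then have y_lim: "(\<lambda>n. y (r n)) \<longlonglongrightarrow> S" using LIMSEQ_subseq_LIMSEQ[OF _ l(1), of y S] by (simp add: o_def)
  \<comment> \<open>Only the limit of the second components is kept; \<open>F\<close> is the limit
    of their half-steps.\<close>
  define F where "F = AS \<beta> (snd l)"
  from dual_le_AS_near[of "snd l", folded F_def] obtain d M
    where d: "dual F (AS \<alpha> F) = ereal d" "\<forall>f g. dual f g \<le> ereal (d + dist f F * M)" .
  have "(\<lambda>n. dist (AS \<beta> (g n)) F) \<longlonglongrightarrow> 0"
    unfolding F_def
    by (rule iffD1[OF tendsto_dist_iff nonexpansive_tendsto[OF AS_nonexpansive[OF \<beta>] g_lim]])
  then have "(\<lambda>n. d + dist (AS \<beta> (g n)) F * M) \<longlonglongrightarrow> d + 0 * M" by (intro tendsto_intros)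
  then have lim: "(\<lambda>n. ereal (d + dist (AS \<beta> (g n)) F * M)) \<longlonglongrightarrow> ereal d" by simp
  have y_le: "y (r n) \<le> ereal (d + dist (AS \<beta> (g n)) F * M)" for n
  proof -
    have "y (r n) = dual (f n) (g n)" by (simp add: k(2) D_def f_def g_def split_def)
    also have "\<dots> \<le> dual (AS \<beta> (g n)) (g n)" by (rule AS_improves)
    also have "\<dots> \<le> ereal (d + dist (AS \<beta> (g n)) F * M)" using d(2) by blast
    finally show ?thesis .
  qed
  have "S \<le> ereal d" by (rule LIMSEQ_le[OF y_lim lim]) (use y_le in blast)
  then have "optimal_potentials \<epsilon> \<phi> C \<alpha> \<beta> F (AS \<alpha> F)"
    using D_le d(1) unfolding optimal_potentials_def by (metis order_trans)
  then show ?thesis by blast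
qed

lemma sinkhorn_converges_of_fixed_point:
  assumes "T p = p"
  shows "sinkhorn_converges \<epsilon> \<phi> C \<alpha> \<beta> g0"
proof -
  have C_flip: "(\<lambda>y x. C x y) = C" by (intro ext C_sym)
  define G where "G t = (T ^^ t) g0" for t
  have G_Suc: "G (Suc t) = T (G t)" for t by (simp add: G_def)
  have G: "apply_bcontfun (G t) = sinkhorn_g \<epsilon> \<phi> C \<alpha> \<beta> (apply_bcontfun g0) t" for t
  proof (induction t)
    case 0
    show ?case by (simp add: G_def)
  next
    case (Suc t)
    then show ?case by (simp add: G_Suc T_def AS_apply[OF \<alpha>] AS_apply[OF \<beta>] C_flip)
  qed
  have F: "apply_bcontfun (AS \<beta> (G t)) = sinkhorn_f \<epsilon> \<phi> C \<alpha> \<beta> (apply_bcontfun g0) t" for t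
    by (simp add: sinkhorn_f_def AS_apply[OF \<beta>] G C_flip)
  from orbit_converges[of p G, OF assms G_Suc] obtain q where q: "T q = q" "G \<longlonglongrightarrow> q" .
  have "(\<lambda>t. AS \<beta> (G t)) \<longlonglongrightarrow> AS \<beta> q"
    by (rule nonexpansive_tendsto[OF AS_nonexpansive[OF \<beta>] q(2)])
  moreover have "optimal_potentials \<epsilon> \<phi> C \<alpha> \<beta> (AS \<beta> q) q"
    using q(1) by (intro fixed_point_optimal) (simp_all add: T_def)
  ultimately show ?thesis
    unfolding sinkhorn_converges_def using F G q(2) by (intro exI conjI allI)
qed

section \<open>A priori bounds on discounted fixed points\<close>

lemma coupling_strict_mono:
  assumes "\<And>y. apply_bcontfun g y < apply_bcontfun h y"
  shows "coupling f g < coupling f h"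
proof -
  have int: "integrable \<beta> (gibbs \<alpha> g f)" for g by (intro integrable_continuous \<beta> gibbs_cont \<alpha>)
  have "0 < (\<integral>y. gibbs \<alpha> h f y - gibbs \<alpha> g f y \<partial>\<beta>)"
    using assms eps_pos
    by (intro integral_pos \<beta> continuous_on_diff gibbs_cont \<alpha>) (simp add: divide_less_cancel)
  then show ?thesis using int by (simp add: coupling_snd)
qed

lemma mass_pos: "0 < mass \<alpha>" "0 < mass \<beta>"
  using integral_pos[OF \<alpha>, of "\<lambda>_. 1"] integral_pos[OF \<beta>, of "\<lambda>_. 1"] by (simp_all add: mass_def)

lemma integral_ge_const:
  assumes "nonzero_finite_borel \<mu>" "continuous_on UNIV h" "\<And>x. c \<le> h x"
  shows "c * mass \<mu> \<le> integral\<^sup>L \<mu> (h :: 'a \<Rightarrow> real)"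
proof -
  have "(\<integral>x. c \<partial>\<mu>) \<le> integral\<^sup>L \<mu> h"
    by (intro integral_mono integrable_continuous assms continuous_on_const)
  then show ?thesis by (simp add: mass_def mult.commute)
qed

lemma integral_le_const:
  assumes "nonzero_finite_borel \<mu>" "continuous_on UNIV h" "\<And>x. h x \<le> c"
  shows "integral\<^sup>L \<mu> (h :: 'a \<Rightarrow> real) \<le> c * mass \<mu>"
proof -
  have "integral\<^sup>L \<mu> h \<le> (\<integral>x. c \<partial>\<mu>)"
    by (intro integral_mono integrable_continuous assms continuous_on_const)
  then show ?thesis by (simp add: mass_def mult.commute)
qed

text \<open>If a discounted fixed point is very large (or very small), the subgradients of the conjugate fix
  the order of the two marginal masses of the coupling. This contradicts the strict monotonicity
  of the coupling between \<open>r g\<close> and \<open>g\<close>.\<close>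

lemma fixed_point_exists:
  assumes up: "\<And>q s. conj_subgradient \<phi> q s \<Longrightarrow> Q < q \<Longrightarrow> b \<le> s"
    and lo: "\<And>q s. conj_subgradient \<phi> q s \<Longrightarrow> q < - Q \<Longrightarrow> s \<le> a"
    and Q: "0 \<le> Q"
    and masses: "a * mass \<beta> \<le> b * mass \<alpha>" "a * mass \<alpha> \<le> b * mass \<beta>"
  obtains p where "T p = p"
proof -
  obtain K where K: "0 \<le> K" "\<And>z. \<bar>smin \<alpha> 0 z\<bar> \<le> K" using smin_zero_bounded[OF \<alpha>] by blast
  obtain D where D: "0 \<le> D" "\<And>x y :: 'a. \<gamma> * dist x y \<le> D" using diameter_bound by blast
  \<comment> \<open>\<open>K\<close> bounds the softmin of 0, \<open>D\<close> the oscillations, and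
    \<open>Q\<close> is the threshold of the subgradient bounds. The further \<open>D\<close> in the
    claim spreads the violation from one point to the whole space.\<close>
  define M where "M = K + D + Q"
  have "\<bar>apply_bcontfun g z\<bar> \<le> M + D" if r: "0 < r" "r < 1" and T: "T (r *\<^sub>R g) = g" for r g z
  proof -
    define f where "f = AS \<beta> (r *\<^sub>R g)"
    have g: "g = AS \<alpha> f" using T by (simp add: T_def f_def)
    have f_osc: "\<bar>apply_bcontfun f x - apply_bcontfun f y\<bar> \<le> D" for x y
      unfolding f_def using AS_lipschitz[OF \<beta>] D(2) order_trans by blast
    have g_osc: "\<bar>apply_bcontfun g x - apply_bcontfun g y\<bar> \<le> D" for x y
      unfolding g using AS_lipschitz[OF \<alpha>] D(2) order_trans by blast
    define s where "s = gibbs \<beta> f (r *\<^sub>R g)"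
    define t where "t = gibbs \<alpha> g f"
    have s: "conj_subgradient \<phi> (- apply_bcontfun f x) (s x)" for x
      unfolding s_def f_def by (rule AS_subgradient[OF \<beta>])
    have t: "conj_subgradient \<phi> (- apply_bcontfun g x) (t x)" for x
      unfolding t_def g by (rule AS_subgradient[OF \<alpha>])
    have cont: "continuous_on UNIV s" "continuous_on UNIV t"
      unfolding s_def t_def by (intro gibbs_cont \<alpha> \<beta>)+
    have cs: "coupling f (r *\<^sub>R g) = integral\<^sup>L \<alpha> s" unfolding s_def by (rule coupling_fst)
    have ct: "coupling f g = integral\<^sup>L \<beta> t" unfolding t_def by (rule coupling_snd)
    show ?thesis
    proof (rule ccontr)
      assume "\<not> ?thesis"
      then consider "M + D < apply_bcontfun g z" | "apply_bcontfun g z < - (M + D)" by linarith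
      then show False
      proof cases
        case 1
        have gM: "M < apply_bcontfun g y" for y using g_osc[of z y] 1 by linarith
        have g0: "0 < apply_bcontfun g y" "Q < apply_bcontfun g y" for y
          using gM[of y] K(1) D(1) Q by (auto simp: M_def)
        have g_le: "apply_bcontfun g y \<le> smin \<alpha> f y" for y
        proof -
          have "t y \<le> 1" using subgradient_le_one[OF t[of y]] g0(1)[of y] by simp
          then show ?thesis using eps_pos by (simp add: t_def divide_le_0_iff)
        qed
        \<comment> \<open>A large \<open>g\<close> forces \<open>f\<close> far down: if
          \<open>f\<close> were at least \<open>- Q\<close> somewhere, it would be at least
          \<open>- (Q + D)\<close> everywhere, and its softmin, which dominates \<open>g\<close>,
          would be at most \<open>M\<close>.\<close>
        have fQ: "apply_bcontfun f x < - Q" for x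
        proof (rule ccontr)
          assume f: "\<not> apply_bcontfun f x < - Q"
          have "apply_bcontfun 0 w \<le> apply_bcontfun f w + (Q + D)" for w
            using f_osc[of x w] f by simp
          then have "smin \<alpha> f x \<le> smin \<alpha> 0 x + (Q + D)" by (intro smin_le[OF \<alpha>] AE_I2)
          then show False using g_le[of x] gM[of x] K(2)[of x] by (simp add: M_def)
        qed
        have "b * mass \<alpha> \<le> coupling f (r *\<^sub>R g)"
          unfolding cs using up[OF s] fQ by (intro integral_ge_const \<alpha> cont) (simp add: less_minus_iff)
        also have "\<dots> < coupling f g"
          using r g0(1) by (intro coupling_strict_mono) (simp add: mult_less_cancel_right1)
        also have "\<dots> \<le> a * mass \<beta>"
          unfolding ct using lo[OF t] g0(2) by (intro integral_le_const \<beta> cont) simp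
        finally show False using masses(1) by simp
      next
        case 2
        have gM: "apply_bcontfun g y < - M" for y using g_osc[of z y] 2 by linarith
        have g0: "apply_bcontfun g y < 0" "apply_bcontfun g y < - Q" for y
          using gM[of y] K(1) D(1) Q by (auto simp: M_def)
        have g_ge: "smin \<alpha> f y \<le> apply_bcontfun g y" for y
        proof -
          have "1 \<le> t y" using subgradient_ge_one[OF t[of y]] g0(1)[of y] by simp
          then show ?thesis using eps_pos by (simp add: t_def zero_le_divide_iff)
        qed
        have fQ: "Q < apply_bcontfun f x" for x
        proof (rule ccontr)
          assume f: "\<not> Q < apply_bcontfun f x"
          have "apply_bcontfun f w \<le> apply_bcontfun 0 w + (Q + D)" for w
            using f_osc[of x w] f by simp
          then have "smin \<alpha> 0 x \<le> smin \<alpha> f x + (Q + D)" by (intro smin_le[OF \<alpha>] AE_I2)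
          then show False using g_ge[of x] gM[of x] K(2)[of x] by (simp add: M_def)
        qed
        have "b * mass \<beta> \<le> coupling f g"
          unfolding ct using up[OF t] g0(2) by (intro integral_ge_const \<beta> cont) (simp add: less_minus_iff)
        also have "\<dots> < coupling f (r *\<^sub>R g)"
          using r g0(1) by (intro coupling_strict_mono) (simp add: mult_less_cancel_right1 not_le)
        also have "\<dots> \<le> a * mass \<alpha>"
          unfolding cs using lo[OF s] fQ by (intro integral_le_const \<alpha> cont) simp
        finally show False using masses(2) by simp
      qed
    qed
  qed
  then show ?thesis using fixed_point_of_discounted that by blast
qed

text \<open>The minorant of slope 0 gives \<open>s \<le> c / \<bar>q\<bar>\<close> for negative
  \<open>q\<close>, so subgradients become as small as the mass ratios require; on the positive side
  they are at least 1.\<close>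

lemma fixed_point_finite_at_zero:
  assumes "\<phi> 0 = ereal c"
  obtains p where "T p = p"
proof -
  define a where "a = min (mass \<alpha> / mass \<beta>) (mass \<beta> / mass \<alpha>)"
  have a: "0 < a" "a \<le> mass \<alpha> / mass \<beta>" "a \<le> mass \<beta> / mass \<alpha>"
    unfolding a_def using mass_pos by auto
  have c: "0 \<le> c" using phi_nonneg[of 0] assms by simp
  show ?thesis
  proof (rule fixed_point_exists[of "c / a" 1 a])
    fix q s assume sub: "conj_subgradient \<phi> q s"
    show "1 \<le> s" if "c / a < q"
      using subgradient_ge_one[OF sub] that c a(1) by (meson divide_nonneg_pos order_le_less_trans)
    show "s \<le> a" if q: "q < - (c / a)"
    proof -
      have "c < a * - q" using q a(1) by (simp add: field_simps)
      moreover have "- c \<le> s * q" using conj_subgradient_ge[OF sub _ assms conj_zero] by simp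
      ultimately have "a * q < s * q" by simp
      moreover have "q < 0" using q c a(1) by (meson divide_nonneg_pos le_less_trans neg_less_0_iff_less neg_le_0_iff_le order_less_le_trans)
      ultimately show ?thesis by (simp add: mult_less_cancel_right)
    qed
  next
    show "0 \<le> c / a" using c a(1) by simp
    show "a * mass \<beta> \<le> 1 * mass \<alpha>" "a * mass \<alpha> \<le> 1 * mass \<beta>"
      using a mass_pos by (simp_all add: field_simps)
  qed (rule that)
qed

text \<open>The conjugate is infinite beyond \<open>k\<close>, so there are no subgradients there
  and \<open>b\<close> may be as large as the mass ratios require; on the negative side subgradients
  are at most 1.\<close>

lemma fixed_point_linear_growth:
  assumes "\<And>p. 1 \<le> p \<Longrightarrow> \<phi> p \<le> ereal (k * p)"
  obtains p where "T p = p"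
proof -
  define b where "b = max (mass \<alpha> / mass \<beta>) (mass \<beta> / mass \<alpha>)"
  have b: "mass \<alpha> / mass \<beta> \<le> b" "mass \<beta> / mass \<alpha> \<le> b" unfolding b_def by auto
  have le_k: "q \<le> k" if sub: "conj_subgradient \<phi> q s" for q s
  proof (rule ccontr)
    assume "\<not> q \<le> k"
    obtain u where u: "conj_fun \<phi> q = ereal u" using sub unfolding conj_subgradient_def by blast
    \<comment> \<open>Large enough for \<open>p * (q - k)\<close> to exceed the supposed finite
      value \<open>u\<close>, and at least 1 for the growth bound.\<close>
    define p where "p = max 1 (u / (q - k) + 1)"
    have p: "1 \<le> p" "u / (q - k) < p" by (auto simp: p_def)
    then have "u < p * (q - k)" using \<open>\<not> q \<le> k\<close> by (simp add: pos_divide_less_eq)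
    have "ereal (p * q) - ereal (k * p) \<le> ereal (p * q) - \<phi> p"
      by (intro ereal_minus_mono assms p order_refl)
    also have "\<dots> \<le> ereal u" using conj_fun_ge[of p q \<phi>] p(1) u by simp
    finally have "p * (q - k) \<le> u" by (simp add: algebra_simps)
    then show False using \<open>u < p * (q - k)\<close> by simp
  qed
  show ?thesis
  proof (rule fixed_point_exists[of "max 0 k" b 1])
    fix q s assume sub: "conj_subgradient \<phi> q s"
    show "b \<le> s" if "max 0 k < q" using le_k[OF sub] that by simp
    show "s \<le> 1" if "q < - max 0 k" using subgradient_le_one[OF sub] that by simp
  next
    show "1 * mass \<beta> \<le> b * mass \<alpha>" "1 * mass \<alpha> \<le> b * mass \<beta>"
      using b mass_pos by (simp_all add: field_simps)
  qed (simp_all add: that)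
qed

text \<open>Zeros of \<phi> at \<open>a\<close> and \<open>b\<close> are linear minorants of the
  conjugate, so the bounds on subgradients hold with threshold 0.\<close>

lemma fixed_point_range:
  assumes "\<phi> a = 0" "\<phi> b = 0" "0 \<le> a" "0 \<le> b"
    and "a * mass \<beta> \<le> b * mass \<alpha>" "a * mass \<alpha> \<le> b * mass \<beta>"
  obtains p where "T p = p"
proof (rule fixed_point_exists[of 0 b a])
  fix q s assume sub: "conj_subgradient \<phi> q s"
  have "a * q \<le> s * q" "b * q \<le> s * q"
    using conj_subgradient_ge[OF sub, of _ 0] assms conj_zero by (simp_all add: zero_ereal_def)
  then show "0 < q \<Longrightarrow> b \<le> s" "q < - 0 \<Longrightarrow> s \<le> a" by (simp_all add: mult_le_cancel_right)
qed (use assms that in auto)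

end

subsection \<open>Entropies\<close>

lemma powr_le_tangent:
  fixes p s :: real
  assumes "0 \<le> p" "0 < s" "s < 1"
  shows "p powr s \<le> 1 + s * (p - 1)"
proof (cases "p = 0")
  case False
  then have p: "0 < p" using assms(1) by simp
  \<comment> \<open>Weighted AM-GM: with weights \<open>s\<close> and \<open>1 - s\<close> the terms
    linear in \<open>ln p\<close> cancel.\<close>
  have "p powr s = p powr s * (s * (1 + (1 - s) * ln p) + (1 - s) * (1 + - s * ln p))"
    by (simp add: algebra_simps)
  also have "\<dots> \<le> p powr s * (s * exp ((1 - s) * ln p) + (1 - s) * exp (- s * ln p))"
    using assms(2,3) by (intro mult_left_mono add_mono exp_ge_add_one_self) auto
  also have "\<dots> = 1 + s * (p - 1)"
    using p by (simp add: powr_def algebra_simps exp_add[symmetric] flip: exp_add)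
  finally show ?thesis .
qed (use assms in auto)

lemma powr_ge_tangent:
  fixes p s :: real
  assumes "0 < p" "s < 0"
  shows "1 + s * (p - 1) \<le> p powr s"
proof -
  have "s * (p - 1) \<le> s * ln p" using ln_le_minus_one[OF assms(1)] assms(2) by (intro mult_left_mono_neg) auto
  also have "\<dots> \<le> exp (s * ln p) - 1" using exp_ge_add_one_self[of "s * ln p"] by linarith
  finally show ?thesis using assms(1) by (simp add: powr_def)
qed

lemma kl_entropy_nonneg: "0 < \<rho> \<Longrightarrow> 0 \<le> p \<Longrightarrow> 0 \<le> kl_entropy \<rho> p"
proof (cases "p = 0")
  case False
  assume *: "0 < \<rho>" "0 \<le> p"
  then have p: "0 < p" using False by simp
  then have "p * ln (1 / p) \<le> p * (1 / p - 1)" by (intro mult_left_mono ln_le_minus_one) auto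
  then have "0 \<le> p * ln p - p + 1" using p by (simp add: ln_div algebra_simps)
  then show ?thesis using * by (simp add: kl_entropy_def)
qed (simp add: kl_entropy_def)

text \<open>The coefficient and the tangent gap of the power change sign together: both are
  nonpositive for \<open>0 < s\<close> and nonnegative for \<open>s < 0\<close>.\<close>

lemma power_entropy_nonneg:
  assumes "0 < \<rho>" "s < 1" "s \<noteq> 0" "0 \<le> p"
  shows "0 \<le> power_entropy \<rho> s p"
proof (cases "0 < s")
  case True
  have "s * (s - 1) < 0" using True assms by (simp add: mult_less_0_iff)
  then have "\<rho> / (s * (s - 1)) \<le> 0" using assms(1) by (simp add: divide_le_0_iff)
  moreover have "p powr s - s * (p - 1) - 1 \<le> 0" using powr_le_tangent[OF assms(4) True assms(2)] by simp
  ultimately have "0 \<le> \<rho> / (s * (s - 1)) * (p powr s - s * (p - 1) - 1)" by (rule mult_nonpos_nonpos)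
  then show ?thesis using True assms(4) by (simp add: power_entropy_def del: times_divide_eq_left)
next
  case False
  then have s: "s < 0" using assms(3) by simp
  show ?thesis
  proof (cases "p = 0")
    case False
    then have "0 \<le> p powr s - s * (p - 1) - 1" using powr_ge_tangent[of p s] s assms(4) by simp
    moreover have "0 \<le> \<rho> / (s * (s - 1))" using s assms(1) by (simp add: zero_le_divide_iff zero_le_mult_iff)
    ultimately have "0 \<le> \<rho> / (s * (s - 1)) * (p powr s - s * (p - 1) - 1)" by (intro mult_nonneg_nonneg)
    then show ?thesis using False assms(4) by (simp add: power_entropy_def del: times_divide_eq_left)
  qed (use s in \<open>simp add: power_entropy_def\<close>)
qed

lemma power_entropy_linear_growth:
  assumes "0 < \<rho>" "s < 0" "1 \<le> p"
  shows "power_entropy \<rho> s p \<le> ereal ((\<rho> / (s * (s - 1)) * - s) * p)"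
proof -
  have "p powr s \<le> 1" using powr_mono[of s 0 p] assms by simp
  then have "p powr s - s * (p - 1) - 1 \<le> - s * p" using assms(2) by (simp add: algebra_simps)
  moreover have "0 \<le> \<rho> / (s * (s - 1))" using assms by (simp add: zero_le_divide_iff zero_le_mult_iff)
  ultimately have "\<rho> / (s * (s - 1)) * (p powr s - s * (p - 1) - 1) \<le> \<rho> / (s * (s - 1)) * (- s * p)"
    by (rule mult_left_mono)
  then show ?thesis
    using assms(2,3) by (simp add: power_entropy_def mult.assoc del: times_divide_eq_left)
qed

lemma nonzero_radon_imp_finite_borel:
  "\<mu> \<in> nonzero_radon_measures \<Longrightarrow> nonzero_finite_borel \<mu>"
  unfolding nonzero_radon_measures_def radon_measures_def nonzero_finite_borel_def by blast

theorem theorem1: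
  fixes C :: "'a::metric_space \<Rightarrow> 'a \<Rightarrow> real"
    and \<alpha> \<beta> :: "'a measure"
    and \<epsilon> \<gamma> :: real
  assumes "compact (UNIV :: 'a set)"
    and "\<alpha> \<in> nonzero_radon_measures"
    and "\<beta> \<in> nonzero_radon_measures"
    and "\<epsilon> > 0"
    and "\<forall>x y. C x y = C y x"
    and "continuous_on UNIV (\<lambda>(x, y). C x y)"
    and "\<forall>x y z. \<bar>C x z - C y z\<bar> \<le> \<gamma> * dist x y"
  shows
    "(\<forall>\<phi>. entropy_function \<phi> \<longrightarrow>
        (\<exists>K :: (('a \<Rightarrow>\<^sub>C real) \<times> ('a \<Rightarrow>\<^sub>C real)) set. compact K \<and>
           (SUP (f, g)\<in>K. dual_functional \<epsilon> \<phi> C \<alpha> \<beta> f g)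
             = (SUP (f, g)\<in>UNIV. dual_functional \<epsilon> \<phi> C \<alpha> \<beta> f g)) \<longrightarrow>
        (\<exists>f g. optimal_potentials \<epsilon> \<phi> C \<alpha> \<beta> f g) \<and>
        (\<forall>g0. sinkhorn_converges \<epsilon> \<phi> C \<alpha> \<beta> g0)) \<and>
     (mass \<alpha> = mass \<beta> \<longrightarrow>
        (\<forall>g0. sinkhorn_converges \<epsilon> (convex_indicator {1}) C \<alpha> \<beta> g0)) \<and>
     (\<forall>\<rho>>0. \<forall>g0. sinkhorn_converges \<epsilon> (kl_entropy \<rho>) C \<alpha> \<beta> g0) \<and>
     (\<forall>a b. 0 \<le> a \<longrightarrow> a \<le> 1 \<longrightarrow> 1 \<le> b \<longrightarrow>
        {a * mass \<alpha>..b * mass \<alpha>} \<inter> {a * mass \<beta>..b * mass \<beta>} \<noteq> {} \<longrightarrow>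
        (\<forall>g0. sinkhorn_converges \<epsilon> (convex_indicator {a..b}) C \<alpha> \<beta> g0)) \<and>
     (\<forall>\<rho>>0. \<forall>g0. sinkhorn_converges \<epsilon> (tv_entropy \<rho>) C \<alpha> \<beta> g0) \<and>
     (\<forall>\<rho>>0. \<forall>s<1. s \<noteq> 0 \<longrightarrow>
        (\<forall>g0. sinkhorn_converges \<epsilon> (power_entropy \<rho> s) C \<alpha> \<beta> g0)) \<and>
     (\<forall>\<rho>>0. \<forall>g0. sinkhorn_converges \<epsilon> (berg_entropy \<rho>) C \<alpha> \<beta> g0)"
proof -
  \<comment> \<open>No sign of \<gamma> is given, so the locale is instantiated with its absolute
    value, again a Lipschitz constant.\<close>
  have pair: "sinkhorn_pair \<phi> \<epsilon> C \<bar>\<gamma>\<bar> \<alpha> \<beta>"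
    if "\<And>p. 0 \<le> p \<Longrightarrow> 0 \<le> \<phi> p" "\<phi> 1 = 0" for \<phi>
  proof
    show "\<bar>C x z - C y z\<bar> \<le> \<bar>\<gamma>\<bar> * dist x y" for x y z
      using assms(7) mult_right_mono[OF abs_ge_self zero_le_dist, of \<gamma> x y] order_trans by blast
  qed (use assms that nonzero_radon_imp_finite_borel in auto)
  have general: "(\<exists>f g. optimal_potentials \<epsilon> \<phi> C \<alpha> \<beta> f g) \<and> (\<forall>g0. sinkhorn_converges \<epsilon> \<phi> C \<alpha> \<beta> g0)"
    if \<phi>: "entropy_function \<phi>" and K: "compact K"
      "(SUP (f, g)\<in>K. dual_functional \<epsilon> \<phi> C \<alpha> \<beta> f g) = (SUP (f, g)\<in>UNIV. dual_functional \<epsilon> \<phi> C \<alpha> \<beta> f g)"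
    for \<phi> and K :: "(('a \<Rightarrow>\<^sub>C real) \<times> ('a \<Rightarrow>\<^sub>C real)) set"
  proof -
    interpret sinkhorn_pair \<phi> \<epsilon> C "\<bar>\<gamma>\<bar>" \<alpha> \<beta>
      by (rule pair) (use \<phi> in \<open>simp_all add: entropy_function_def\<close>)
    obtain f g where opt: "optimal_potentials \<epsilon> \<phi> C \<alpha> \<beta> f g"
      using optimal_potentials_exist[OF K] by blast
    obtain p where "T p = p" by (rule optimal_imp_fixed_point[OF opt])
    then show ?thesis using opt sinkhorn_converges_of_fixed_point by blast
  qed
  have finite_at_zero: "sinkhorn_converges \<epsilon> \<phi> C \<alpha> \<beta> g0"
    if "\<And>p. 0 \<le> p \<Longrightarrow> 0 \<le> \<phi> p" "\<phi> 1 = 0" "\<phi> 0 = ereal c" for \<phi> c g0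
  proof -
    interpret sinkhorn_pair \<phi> \<epsilon> C "\<bar>\<gamma>\<bar>" \<alpha> \<beta> by (rule pair[of \<phi>, OF that(1,2)])
    show ?thesis using fixed_point_finite_at_zero[OF that(3)] sinkhorn_converges_of_fixed_point by metis
  qed
  have linear_growth: "sinkhorn_converges \<epsilon> \<phi> C \<alpha> \<beta> g0"
    if "\<And>p. 0 \<le> p \<Longrightarrow> 0 \<le> \<phi> p" "\<phi> 1 = 0" "\<And>p. 1 \<le> p \<Longrightarrow> \<phi> p \<le> ereal (k * p)" for \<phi> k g0
  proof -
    interpret sinkhorn_pair \<phi> \<epsilon> C "\<bar>\<gamma>\<bar>" \<alpha> \<beta> by (rule pair[of \<phi>, OF that(1,2)])
    show ?thesis using fixed_point_linear_growth[OF that(3)] sinkhorn_converges_of_fixed_point by metis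
  qed
  have range: "sinkhorn_converges \<epsilon> (convex_indicator {a..b}) C \<alpha> \<beta> g0"
    if ab: "0 \<le> a" "a \<le> 1" "1 \<le> b"
      "{a * mass \<alpha>..b * mass \<alpha>} \<inter> {a * mass \<beta>..b * mass \<beta>} \<noteq> {}" for a b g0
  proof -
    interpret sinkhorn_pair "convex_indicator {a..b}" \<epsilon> C "\<bar>\<gamma>\<bar>" \<alpha> \<beta>
      by (rule pair) (use ab in \<open>simp_all add: convex_indicator_def\<close>)
    obtain p where "T p = p"
      by (rule fixed_point_range[of a b]) (use ab in \<open>auto simp: convex_indicator_def\<close>)
    then show ?thesis by (rule sinkhorn_converges_of_fixed_point)
  qed
  have balanced: "sinkhorn_converges \<epsilon> (convex_indicator {1}) C \<alpha> \<beta> g0" if "mass \<alpha> = mass \<beta>" for g0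
    using range[of 1 1 g0] that by simp
  have kl: "sinkhorn_converges \<epsilon> (kl_entropy \<rho>) C \<alpha> \<beta> g0" if "0 < \<rho>" for \<rho> g0
    by (rule finite_at_zero[of _ \<rho>]) (use that in \<open>simp_all add: kl_entropy_nonneg\<close>, simp_all add: kl_entropy_def)
  have tv: "sinkhorn_converges \<epsilon> (tv_entropy \<rho>) C \<alpha> \<beta> g0" if "0 < \<rho>" for \<rho> g0
    by (rule finite_at_zero[of _ \<rho>]) (use that in \<open>simp_all add: tv_entropy_def\<close>)
  have power: "sinkhorn_converges \<epsilon> (power_entropy \<rho> s) C \<alpha> \<beta> g0"
    if "0 < \<rho>" "s < 1" "s \<noteq> 0" for \<rho> s g0
  proof (cases "0 < s")
    case True
    have 1: "power_entropy \<rho> s 1 = 0" by (simp add: power_entropy_def zero_ereal_def)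
    \<comment> \<open>Since \<open>0 powr s = 0\<close>, the bracket reduces to \<open>s - 1\<close>
      and the value is \<open>\<rho> / s\<close>.\<close>
    have 2: "power_entropy \<rho> s 0 = ereal (\<rho> / (s * (s - 1)) * (s - 1))" using True by (simp add: power_entropy_def)
    show ?thesis by (rule finite_at_zero[OF power_entropy_nonneg[OF that] 1 2])
  next
    case False
    then have s: "s < 0" using that(3) by simp
    have 1: "power_entropy \<rho> s 1 = 0" by (simp add: power_entropy_def zero_ereal_def)
    show ?thesis
      by (rule linear_growth[OF power_entropy_nonneg[OF that] 1 power_entropy_linear_growth[OF that(1) s]])
  qed
  have berg: "sinkhorn_converges \<epsilon> (berg_entropy \<rho>) C \<alpha> \<beta> g0" if \<rho>: "0 < \<rho>" for \<rho> g0
  proof (rule linear_growth[of _ \<rho>])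
    show "0 \<le> berg_entropy \<rho> p" if "0 \<le> p" for p
      using that \<rho> ln_le_minus_one[of p] by (simp add: berg_entropy_def)
    show "berg_entropy \<rho> 1 = 0" by (simp add: berg_entropy_def zero_ereal_def)
    show "berg_entropy \<rho> p \<le> ereal (\<rho> * p)" if "1 \<le> p" for p
    proof -
      have "\<rho> * (p - 1 - ln p) \<le> \<rho> * p"
        using \<rho> ln_ge_zero[OF that] by (intro mult_left_mono) linarith+
      then show ?thesis using that by (simp add: berg_entropy_def)
    qed
  qed
  show ?thesis using general range balanced kl tv power berg by blast
qed

end
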